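(* Let $\mathbb{A}=(Q,\Sigma,\beta,Q_{in},\delta,F)$ be a Büchi word constraint automaton involving the constants $d_1<\dots<d_\alpha$. There is a deterministic Rabin word constraint automaton $\mathbb{A}'=(Q',\Sigma,\beta,Q'_{in},\delta',\mathcal{F})$ with $L(\mathbb{A})=L(\mathbb{A}')$ such that: (I) $|Q'|$ is exponential in $|Q|$ and the number of Rabin pairs of $\mathbb{A}'$ is bounded by $2\cdot|Q|$; (II) the constraints in the transitions of $\mathbb{A}'$ are from $\mathrm{SatTypes}(\beta)$, are of size cubic in $\beta+\max(\lceil\log|d_1|\rceil,\lceil\log|d_\alpha|\rceil)$, and $|\delta'|\le|Q'|^2\times|\Sigma|\times((d_\alpha-d_1)+3)^{2\beta}3^{2\beta^2}$.
   Context: Constraints are Boolean combinations of atomic constraints $t<t'$, $t=t'$, $t=d$ ($d\in\mathbb{Z}$) over terms $x_1,\dots,x_\beta,x'_1,\dots,x'_\beta$. A Büchi word constraint automaton $(Q,\Sigma,\beta,Q_{in},\delta,F)$ has finite locations $Q$, finite alphabet $\Sigma$, initial set $Q_{in}$, accepting set $F$, and a finite set $\delta$ of transitions $(q,a,\Theta,q')$ with $\Theta$ such a constraint; it accepts $w:\mathbb{N}\to\Sigma\times\mathbb{Z}^\beta$, $w(i)=(a_i,z_i)$, if there is a sequence of transitions $(q_i,a_i,\Theta_i,q_{i+1})\in\delta$ with $q_0\in Q_{in}$, $\Theta_i$ true under $x_j\mapsto z_i(j)$, $x'_j\mapsto z_{i+1}(j)$, and some location of $F$ occurring infinitely often. A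 Rabin word constraint automaton instead has a set $\mathcal{F}$ of pairs $(L,U)$ of subsets of locations, and a run is accepting if for some pair, $L$ is visited infinitely often and $U$ only finitely often. An automaton is deterministic if for every location $q$, letter $a$ and $(z,z')\in\mathbb{Z}^{2\beta}$ there is at most one transition $(q,a,\Theta,q')$ with $\Theta$ true under $x_j\mapsto z(j),x'_j\mapsto z'(j)$. A type over variables $z_1,\dots,z_n$ is a conjunction $\bigwedge_i\Theta_i^{CST}\wedge\bigwedge_{i<j}z_i\sim_{i,j}z_j$ with $\sim_{i,j}\in\{<,=,>\}$ and each $\Theta_i^{CST}$ one of $z_i<d_1$, $z_i>d_\alpha$, or $z_i=d$ for some $d\in[d_1,d_\alpha]$; $\mathrm{SatTypes}(\beta)$ is the set of satisfiable types over the $2\beta$ variables $x_1,\dots,x_\beta,x'_1,\dots,x'_\beta$. *)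

theory Defs
  imports Complex_Main "HOL-Library.Log_Nat" "HOL-Computational_Algebra.Polynomial"
begin

text \<open>The variables are numbered from 0: \<open>Cur j\<close> and \<open>Nxt j\<close> with \<open>j < \<beta>\<close> stand for
  $x_{j+1}$ and $x'_{j+1}$.\<close>

datatype cterm = Cur nat | Nxt nat

text \<open>\<open>Lt\<close>, \<open>Eq\<close> and \<open>EqC\<close> are the atomic constraints of constraint automata. The literals
  \<open>LtC z d\<close> ($z < d$) and \<open>GtC z d\<close> ($z > d$) occur in types; they are not expressible as Boolean
  combinations of the other three, so they are separate atoms, and \<open>basic\<close> singles out
  the constraints without them.\<close>

datatype atom = Lt cterm cterm | Eq cterm cterm | EqC cterm int | LtC cterm int | GtC cterm int

datatype (atoms: 'p) formula =
  TT | Atom 'p | Neg "'p formula" | And "'p formula" "'p formula" | Or "'p formula" "'p formula"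

type_synonym constr = "atom formula"

fun tval :: "int list \<Rightarrow> int list \<Rightarrow> cterm \<Rightarrow> int" where
  "tval z z' (Cur j) = z ! j"
| "tval z z' (Nxt j) = z' ! j"

fun holds_atom :: "int list \<Rightarrow> int list \<Rightarrow> atom \<Rightarrow> bool" where
  "holds_atom z z' (Lt s t) \<longleftrightarrow> tval z z' s < tval z z' t"
| "holds_atom z z' (Eq s t) \<longleftrightarrow> tval z z' s = tval z z' t"
| "holds_atom z z' (EqC t d) \<longleftrightarrow> tval z z' t = d"
| "holds_atom z z' (LtC t d) \<longleftrightarrow> tval z z' t < d"
| "holds_atom z z' (GtC t d) \<longleftrightarrow> tval z z' t > d"

fun holds :: "int list \<Rightarrow> int list \<Rightarrow> constr \<Rightarrow> bool" where
  "holds z z' TT \<longleftrightarrow> True"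
| "holds z z' (Atom p) \<longleftrightarrow> holds_atom z z' p"
| "holds z z' (Neg f) \<longleftrightarrow> \<not> holds z z' f"
| "holds z z' (And f g) \<longleftrightarrow> holds z z' f \<and> holds z z' g"
| "holds z z' (Or f g) \<longleftrightarrow> holds z z' f \<or> holds z z' g"

definition cterms :: "nat \<Rightarrow> cterm list" where
  "cterms \<beta> = map Cur [0..<\<beta>] @ map Nxt [0..<\<beta>]"

fun atom_terms :: "atom \<Rightarrow> cterm set" where
  "atom_terms (Lt s t) = {s, t}"
| "atom_terms (Eq s t) = {s, t}"
| "atom_terms (EqC t d) = {t}"
| "atom_terms (LtC t d) = {t}"
| "atom_terms (GtC t d) = {t}"

fun atom_consts :: "atom \<Rightarrow> int set" where
  "atom_consts (Lt s t) = {}"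
| "atom_consts (Eq s t) = {}"
| "atom_consts (EqC t d) = {d}"
| "atom_consts (LtC t d) = {d}"
| "atom_consts (GtC t d) = {d}"

definition over :: "nat \<Rightarrow> constr \<Rightarrow> bool" where
  "over \<beta> f \<longleftrightarrow> (\<forall>p \<in> atoms f. atom_terms p \<subseteq> set (cterms \<beta>))"

fun basic_atom :: "atom \<Rightarrow> bool" where
  "basic_atom (LtC t d) = False"
| "basic_atom (GtC t d) = False"
| "basic_atom p = True"

definition basic :: "constr \<Rightarrow> bool" where
  "basic f \<longleftrightarrow> (\<forall>p \<in> atoms f. basic_atom p)"

text \<open>Size of an encoding in which variable indices and constants are written in binary
  (\<open>floorlog 2 n\<close> is the number of binary digits of \<open>n\<close>) and every other symbol, including
  the sign of a constant, counts 1.\<close>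

fun term_size :: "cterm \<Rightarrow> nat" where
  "term_size (Cur j) = 1 + floorlog 2 j"
| "term_size (Nxt j) = 1 + floorlog 2 j"

definition int_size :: "int \<Rightarrow> nat" where
  "int_size d = 1 + floorlog 2 (nat \<bar>d\<bar>)"

fun atom_size :: "atom \<Rightarrow> nat" where
  "atom_size (Lt s t) = 1 + term_size s + term_size t"
| "atom_size (Eq s t) = 1 + term_size s + term_size t"
| "atom_size (EqC t d) = 1 + term_size t + int_size d"
| "atom_size (LtC t d) = 1 + term_size t + int_size d"
| "atom_size (GtC t d) = 1 + term_size t + int_size d"

fun constr_size :: "constr \<Rightarrow> nat" where
  "constr_size TT = 1"
| "constr_size (Atom p) = atom_size p"
| "constr_size (Neg f) = 1 + constr_size f"
| "constr_size (And f g) = 1 + constr_size f + constr_size g"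
| "constr_size (Or f g) = 1 + constr_size f + constr_size g"

definition const_lits :: "int \<Rightarrow> int \<Rightarrow> cterm \<Rightarrow> constr set" where
  "const_lits d1 d\<alpha> t = {Atom (LtC t d1), Atom (GtC t d\<alpha>)} \<union> {Atom (EqC t d) | d. d1 \<le> d \<and> d \<le> d\<alpha>}"

definition rel_lits :: "cterm \<times> cterm \<Rightarrow> constr set" where
  "rel_lits = (\<lambda>(s, t). {Atom (Lt s t), Atom (Eq s t), Atom (Lt t s)})"

text \<open>The pairs $(z_i, z_j)$ with $i < j$.\<close>

definition ordered_pairs :: "'v list \<Rightarrow> ('v \<times> 'v) list" where
  "ordered_pairs zs = concat (map (\<lambda>j. map (\<lambda>i. (zs ! i, zs ! j)) [0..<j]) [0..<length zs])"

text \<open>The conjuncts of a type come in a fixed order, so that reorderings of a conjunction do not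
  count as different types.\<close>

definition types :: "int \<Rightarrow> int \<Rightarrow> cterm list \<Rightarrow> constr set" where
  "types d1 d\<alpha> zs = {foldr And (cs @ rs) TT | cs rs.
     list_all2 (\<lambda>c z. c \<in> const_lits d1 d\<alpha> z) cs zs \<and>
     list_all2 (\<lambda>r p. r \<in> rel_lits p) rs (ordered_pairs zs)}"

definition SatTypes :: "int \<Rightarrow> int \<Rightarrow> nat \<Rightarrow> constr set" where
  "SatTypes d1 d\<alpha> \<beta> = {f \<in> types d1 d\<alpha> (cterms \<beta>).
     \<exists>z z'. length z = \<beta> \<and> length z' = \<beta> \<and> holds z z' f}"

record ('q, 'a) aut =
  locs :: "'q set"
  alphabet :: "'a set"
  nvars :: nat
  inits :: "'q set"
  delta :: "('q \<times> 'a \<times> constr \<times> 'q) set"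

record ('q, 'a) buchi_aut = "('q, 'a) aut" +
  accepting :: "'q set"

record ('q, 'a) rabin_aut = "('q, 'a) aut" +
  rabin_pairs :: "('q set \<times> 'q set) set"

definition aut :: "('q, 'a, 'm) aut_scheme \<Rightarrow> bool" where
  "aut A \<longleftrightarrow> finite (locs A) \<and> finite (alphabet A) \<and> inits A \<subseteq> locs A \<and> finite (delta A) \<and>
     delta A \<subseteq> locs A \<times> alphabet A \<times> {f. over (nvars A) f} \<times> locs A"

definition buchi_aut :: "('q, 'a) buchi_aut \<Rightarrow> bool" where
  "buchi_aut A \<longleftrightarrow> aut A \<and> accepting A \<subseteq> locs A \<and> (\<forall>(q, a, f, q') \<in> delta A. basic f)"

definition rabin_aut :: "('q, 'a) rabin_aut \<Rightarrow> bool" where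
  "rabin_aut A \<longleftrightarrow> aut A \<and> rabin_pairs A \<subseteq> Pow (locs A) \<times> Pow (locs A)"

definition deterministic :: "('q, 'a, 'm) aut_scheme \<Rightarrow> bool" where
  "deterministic A \<longleftrightarrow> (\<forall>q \<in> locs A. \<forall>a \<in> alphabet A. \<forall>z z'. length z = nvars A \<and> length z' = nvars A \<longrightarrow>
     (\<exists>\<^sub>\<le>\<^sub>1 (f, q'). (q, a, f, q') \<in> delta A \<and> holds z z' f))"

definition constants :: "('q, 'a, 'm) aut_scheme \<Rightarrow> int set" where
  "constants A = (\<Union>(q, a, f, q') \<in> delta A. \<Union>(atom_consts ` atoms f))"

definition data_words :: "('q, 'a, 'm) aut_scheme \<Rightarrow> (nat \<Rightarrow> 'a \<times> int list) set" where
  "data_words A = {w. \<forall>i. fst (w i) \<in> alphabet A \<and> length (snd (w i)) = nvars A}"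

definition run :: "('q, 'a, 'm) aut_scheme \<Rightarrow> (nat \<Rightarrow> 'a \<times> int list) \<Rightarrow> (nat \<Rightarrow> 'q) \<Rightarrow> bool" where
  "run A w r \<longleftrightarrow> r 0 \<in> inits A \<and>
     (\<forall>i. \<exists>f. (r i, fst (w i), f, r (Suc i)) \<in> delta A \<and> holds (snd (w i)) (snd (w (Suc i))) f)"

definition buchi_lang :: "('q, 'a) buchi_aut \<Rightarrow> (nat \<Rightarrow> 'a \<times> int list) set" where
  "buchi_lang A = {w \<in> data_words A. \<exists>r. run A w r \<and> (\<exists>q \<in> accepting A. \<exists>\<^sub>\<infinity>i. r i = q)}"

definition rabin_lang :: "('q, 'a) rabin_aut \<Rightarrow> (nat \<Rightarrow> 'a \<times> int list) set" where
  "rabin_lang A = {w \<in> data_words A. \<exists>r. run A w r \<and>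
     (\<exists>(L, U) \<in> rabin_pairs A. (\<exists>\<^sub>\<infinity>i. r i \<in> L) \<and> \<not> (\<exists>\<^sub>\<infinity>i. r i \<in> U))}"

text \<open>$\beta + \max(\lceil\log|d_1|\rceil, \lceil\log|d_\alpha|\rceil)$; the value for the constant 0
  is \<open>\<lceil>log 2 0\<rceil> = 0\<close>.\<close>

definition size_param :: "nat \<Rightarrow> int \<Rightarrow> int \<Rightarrow> nat" where
  "size_param \<beta> d1 d\<alpha> = \<beta> + nat (max \<lceil>log 2 \<bar>real_of_int d1\<bar>\<rceil> \<lceil>log 2 \<bar>real_of_int d\<alpha>\<bar>\<rceil>)"

end

theory Submission
  imports Defs
begin

text \<open>
  A type decides every basic constraint over its variables and constants, and each pair of
  valuations satisfies exactly one type, so a data word turns into a word over the finite alphabet of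
  letters and types, each of which acts as a relation on locations. It remains to determinize a
  Buechi automaton reading a sequence of relations $R_0, R_1, \dots$.

  Rank reachable locations by the recursion ``twice the rank of the parent, plus one if accepting'',
  where the parent of a location is a best-ranked predecessor. This makes the reachable locations
  of all levels a forest. Among the locations of a level that start an accepting path, those of
  maximal rank have parents of the same kind, which by Koenig's lemma yields a branch of the forest;
  it visits accepting locations infinitely often, for otherwise an accepting path leaving it would
  eventually outrank it.

  Such a branch is detected with $2|Q|$ slots. A slot follows the set of descendants of a vertex
  and flashes whenever all its members have passed an accepting location since the last flash. The
  sets of descendants form a laminar family, so there are at most $2|Q|$ of them if slots with equal
  sets are merged into the one of smallest index. The Rabin pairs ask for a slot that is
  merged or emptied only finitely often and flashes infinitely often.
\<close>

section \<open>Laminar families and infinite branches\<close>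

definition laminar :: "'a set set \<Rightarrow> bool" where
  "laminar C \<longleftrightarrow> (\<forall>A\<in>C. \<forall>B\<in>C. A \<inter> B = {} \<or> A \<subseteq> B \<or> B \<subseteq> A)"

lemma laminarD: "laminar C \<Longrightarrow> A \<in> C \<Longrightarrow> B \<in> C \<Longrightarrow> A \<inter> B = {} \<or> A \<subseteq> B \<or> B \<subseteq> A"
  by (simp add: laminar_def)

text \<open>Induction on the ground set: one more point \<open>x\<close> costs at most two sets.
  These are the singleton of \<open>x\<close> and one set lost when \<open>x\<close> is deleted from
  all others, since deletion identifies distinct sets only as a pair \<open>Z\<close>,
  \<open>Z - {x}\<close>, and laminarity permits a single such \<open>Z\<close>.\<close>

lemma laminar_card:
  assumes "finite V" "C \<subseteq> Pow V - {{}}" "laminar C"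
  shows "card C \<le> 2 * card V"
  using assms
proof (induction V arbitrary: C rule: finite_induct)
  case empty
  then have "C = {}" by auto
  then show ?case by simp
next
  case (insert x V)
  define C' where "C' = C - {{x}}"
  define P where "P = {Z \<in> C'. x \<in> Z \<and> Z - {x} \<in> C'}"
  define g where "g = (\<lambda>A. A - {x})"
  have finC: "finite C" using insert.prems(1) insert.hyps(1) by (auto intro: finite_subset[of _ "Pow (insert x V)"])
  have lam: "A \<inter> B = {} \<or> A \<subseteq> B \<or> B \<subseteq> A" if "A \<in> C" "B \<in> C" for A B
    using insert.prems(2) that by (auto simp: laminar_def)
  have "laminar (g ` C')"
    unfolding laminar_def ball_simps
  proof (intro ballI)
    fix A B assume "A \<in> C'" "B \<in> C'"
    then show "g A \<inter> g B = {} \<or> g A \<subseteq> g B \<or> g B \<subseteq> g A"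
      using lam[of A B] by (auto simp: g_def C'_def)
  qed
  moreover have "g ` C' \<subseteq> Pow V - {{}}"
    using insert.prems(1) by (auto simp: g_def C'_def)
  ultimately have c0: "card (g ` C') \<le> 2 * card V"
    by (intro insert.IH)
  \<comment> \<open>\<open>Z\<close> has a point besides \<open>x\<close>, and that point lies in
    \<open>Y - {x}\<close>, but \<open>x\<close> does not; so laminarity leaves only
    \<open>Y - {x} \<subseteq> Z\<close>.\<close>
  have P_least: "Y \<subseteq> Z" if "Z \<in> P" "Y \<in> P" "Z \<subseteq> Y" for Z Y
  proof -
    have "Z \<noteq> {x}" "x \<in> Z" "Z \<in> C" "Y - {x} \<in> C" using that by (auto simp: P_def C'_def)
    then have "Y - {x} \<subseteq> Z" using lam[of Z "Y - {x}"] that(3) by auto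
    then show ?thesis using \<open>x \<in> Z\<close> by auto
  qed
  have uniq: "Z = Y" if "Z \<in> P" "Y \<in> P" for Z Y
  proof -
    have "Z \<subseteq> Y \<or> Y \<subseteq> Z" using lam[of Z Y] that by (auto simp: P_def C'_def)
    then show ?thesis using P_least that by (metis subset_antisym)
  qed
  have "finite P" using finC by (simp add: P_def C'_def)
  then have "card P \<le> 1" using uniq by (simp add: card_le_Suc0_iff_eq)
  moreover have "inj_on g (C' - P)"
  proof (rule inj_onI)
    fix A B assume A: "A \<in> C' - P" and B: "B \<in> C' - P" and e: "g A = g B"
    have "x \<in> A \<Longrightarrow> x \<notin> B \<Longrightarrow> B = A - {x}" "x \<in> B \<Longrightarrow> x \<notin> A \<Longrightarrow> A = B - {x}"
      using e by (auto simp: g_def)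
    then have "x \<in> A \<longleftrightarrow> x \<in> B" using A B by (auto simp: P_def)
    then show "A = B" using e by (auto simp: g_def)
  qed
  then have "card (C' - P) \<le> card (g ` C')"
    by (rule card_inj_on_le) (use finC in \<open>auto simp: C'_def\<close>)
  moreover have "card C \<le> card (C' - P) + card P + 1"
  proof -
    have "C \<subseteq> (C' - P) \<union> P \<union> {{x}}" by (auto simp: C'_def)
    then have "card C \<le> card ((C' - P) \<union> P \<union> {{x}})"
      using finC by (intro card_mono) (auto simp: P_def C'_def)
    also have "\<dots> \<le> card ((C' - P) \<union> P) + card {{x}}" by (rule card_Un_le)
    also have "\<dots> \<le> card (C' - P) + card P + card {{x}}" using card_Un_le[of "C' - P" P] by simp
    finally show ?thesis by simp
  qed
  ultimately show ?case using c0 insert.hyps by simp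
qed

text \<open>Koenig's lemma for a forest given by its parent maps \<open>p\<close>. Levels being
  finite, a vertex with descendants at infinitely many depths has a child of the same kind, so a
  branch can be chosen step by step.\<close>

lemma koenig:
  fixes X :: "nat \<Rightarrow> 'a set"
  assumes fin: "\<And>i. finite (X i)" and ne: "\<And>i. X i \<noteq> {}"
    and p: "\<And>i x. x \<in> X (Suc i) \<Longrightarrow> p i x \<in> X i"
  shows "\<exists>b. \<forall>i. b i \<in> X i \<and> p i (b (Suc i)) = b i"
proof -
  \<comment> \<open>\<open>h d i x\<close> means that \<open>x\<close> at level \<open>i\<close> has
    a descendant \<open>d\<close> levels further down.\<close>
  define h where "h = rec_nat (\<lambda>_ _. True) (\<lambda>_ r i x. \<exists>y\<in>X (Suc i). p i y = x \<and> r (Suc i) y)"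
  have h0: "h 0 i x" and hS: "h (Suc d) i x \<longleftrightarrow> (\<exists>y\<in>X (Suc i). p i y = x \<and> h d (Suc i) y)" for d i x
    by (simp_all add: h_def)
  have ex: "x \<in> X (i + d) \<Longrightarrow> \<exists>y\<in>X i. h d i y" for d i x
  proof (induction d arbitrary: i)
    case 0 then show ?case by (auto simp: h0)
  next
    case (Suc d)
    obtain y where "y \<in> X (Suc i)" "h d (Suc i) y" using Suc.IH[of "Suc i"] Suc.prems by auto
    then show ?case using p by (auto simp: hS)
  qed
  \<comment> \<open>Asking for infinitely many depths lets the quantifier distribute over the
    finitely many candidates of a level.\<close>
  define P where "P = (\<lambda>i x. x \<in> X i \<and> (\<exists>\<^sub>\<infinity>d. h d i x))"
  have "\<exists>f. \<forall>i. P i (f i) \<and> p i (f (Suc i)) = f i"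
  proof (rule dependent_nat_choice)
    have "\<exists>x\<in>X 0. h d 0 x" for d using ex[of _ 0 d] ne[of d] by auto
    then have "\<exists>\<^sub>\<infinity>d. \<exists>x\<in>X 0. h d 0 x" unfolding INFM_nat by blast
    then show "\<exists>x. P 0 x" by (auto simp: P_def frequently_bex_finite_distrib[OF fin])
  next
    fix x i assume "P i x"
    then have "\<exists>\<^sub>\<infinity>d. h d i x" by (simp add: P_def)
    then have "\<exists>\<^sub>\<infinity>d. h (Suc d) i x"
      unfolding INFM_nat by (metis Suc_lessE Suc_less_eq less_Suc_eq)
    then have "\<exists>\<^sub>\<infinity>d. \<exists>y\<in>X (Suc i). p i y = x \<and> h d (Suc i) y" by (simp add: hS)
    then show "\<exists>y. P (Suc i) y \<and> p i y = x"
      unfolding frequently_bex_finite_distrib[OF fin] P_def INFM_nat by blast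
  qed
  then show ?thesis unfolding P_def by blast
qed

section \<open>A deterministic acceptor for words over relations\<close>

text \<open>A pair \<open>(x, y)\<close> in \<open>pref\<close> says that \<open>x\<close> ranks at
  least as high as \<open>y\<close>. \<open>marked\<close> holds the members of each slot that have
  passed an accepting location since its last flash. \<open>flash\<close> and \<open>reset\<close>
  report on the step just taken, so that acceptance can be read off the states.\<close>

record 'q dstate =
  reach :: "'q set"
  pref :: "('q \<times> 'q) set"
  trace :: "(nat \<times> 'q) set"
  marked :: "(nat \<times> 'q) set"
  flash :: "nat set"
  reset :: "nat set"

text \<open>Ties between best predecessors are broken by choice, which depends only on the state and
  the relation; the successor state therefore remains a function of both.\<close>

definition parent :: "'q dstate \<Rightarrow> ('q \<times> 'q) set \<Rightarrow> 'q \<Rightarrow> 'q" where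
  "parent s R y = (SOME x. x \<in> reach s \<and> (x, y) \<in> R \<and>
     (\<forall>x'\<in>reach s. (x', y) \<in> R \<longrightarrow> (x, x') \<in> pref s))"

definition children :: "'q dstate \<Rightarrow> ('q \<times> 'q) set \<Rightarrow> 'q set \<Rightarrow> 'q set" where
  "children s R X = {y \<in> R `` reach s. parent s R y \<in> X}"

text \<open>Slot \<open>k\<close> holds the set \<open>trace s `` {k}\<close>; it is free when this set is empty.\<close>

definition moved :: "'q dstate \<Rightarrow> ('q \<times> 'q) set \<Rightarrow> nat \<Rightarrow> 'q set" where
  "moved s R k = children s R (trace s `` {k})"

definition kept :: "nat \<Rightarrow> 'q dstate \<Rightarrow> ('q \<times> 'q) set \<Rightarrow> nat set" where
  "kept n s R = {k. k < n \<and> moved s R k \<noteq> {} \<and> (\<forall>j<k. moved s R j \<noteq> moved s R k)}"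

text \<open>The marks after a step but before a flash clears them: inherited from the parent or
  gained by being accepting.\<close>

definition remark :: "'q set \<Rightarrow> 'q dstate \<Rightarrow> ('q \<times> 'q) set \<Rightarrow> nat \<Rightarrow> 'q set" where
  "remark F s R k = {y \<in> moved s R k. parent s R y \<in> marked s `` {k} \<or> y \<in> F}"

definition flashing :: "nat \<Rightarrow> 'q set \<Rightarrow> 'q dstate \<Rightarrow> ('q \<times> 'q) set \<Rightarrow> nat set" where
  "flashing n F s R = {k \<in> kept n s R. remark F s R k = moved s R k}"

text \<open>All singletons are tracked at every level, since it is not known at which vertex the
  branch to be detected separates from the others.\<close>

definition refill :: "nat \<Rightarrow> 'q dstate \<Rightarrow> ('q \<times> 'q) set \<Rightarrow> nat \<Rightarrow> 'q set" where
  "refill n s R = (SOME g. (\<forall>k\<in>kept n s R. g k = moved s R k) \<and>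
     (\<forall>k\<in>{..<n} - kept n s R. g k = {} \<or> (\<exists>y. g k = {y})) \<and>
     (\<forall>y\<in>R `` reach s. \<exists>k<n. g k = {y}))"

text \<open>Preference is lexicographic: parents first, then acceptance. Cutting
  \<open>refill\<close> down to the reachable set keeps the result a proper state even where the
  choice in \<open>refill\<close> has no witness.\<close>

definition step :: "nat \<Rightarrow> 'q set \<Rightarrow> ('q \<times> 'q) set \<Rightarrow> 'q dstate \<Rightarrow> 'q dstate" where
  "step n F R s =
    \<lparr>reach = R `` reach s,
     pref = {(x, y). x \<in> R `` reach s \<and> y \<in> R `` reach s \<and> (parent s R x, parent s R y) \<in> pref s \<and>
       ((parent s R y, parent s R x) \<in> pref s \<longrightarrow> y \<in> F \<longrightarrow> x \<in> F)},
     trace = {(k, y). k < n \<and> y \<in> refill n s R k \<inter> R `` reach s},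
     marked = {(k, y). k \<in> kept n s R - flashing n F s R \<and> y \<in> remark F s R k},
     flash = flashing n F s R,
     reset = {..<n} - kept n s R\<rparr>"

text \<open>No slot is occupied at level 0; singletons are tracked from level 1 on.\<close>

definition start :: "nat \<Rightarrow> 'q set \<Rightarrow> 'q dstate" where
  "start n I = \<lparr>reach = I, pref = I \<times> I, trace = {}, marked = {}, flash = {}, reset = {..<n}\<rparr>"

section \<open>Size of the state space\<close>

definition dstates :: "'q set \<Rightarrow> 'q dstate set" where
  "dstates Q = (let K = {..<2 * card Q} in
    {s. reach s \<subseteq> Q \<and> pref s \<subseteq> Q \<times> Q \<and> trace s \<subseteq> K \<times> Q \<and> marked s \<subseteq> K \<times> Q \<and> flash s \<subseteq> K \<and> reset s \<subseteq> K})"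

text \<open>The exponent counts bits, with c = |Q|: c for \<open>reach\<close>, c^2 for
  \<open>pref\<close>, 2c^2 each for \<open>trace\<close> and \<open>marked\<close>, 2c each for
  \<open>flash\<close> and \<open>reset\<close>.\<close>

lemma card_dstates:
  assumes "finite Q"
  shows "finite (dstates Q)" and "card (dstates Q) \<le> 2 ^ (5 * card Q * card Q + 5 * card Q)"
proof -
  define K where "K = {..<2 * card Q}"
  define T where "T = Pow Q \<times> Pow (Q \<times> Q) \<times> Pow (K \<times> Q) \<times> Pow (K \<times> Q) \<times> Pow K \<times> Pow K"
  define mk where "mk = (\<lambda>(a, b, c, d, e, f).
    \<lparr>reach = a, pref = b, trace = c, marked = d, flash = e, reset = f\<rparr> :: 'a dstate)"
  have finT: "finite T" using assms by (auto simp: T_def K_def)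
  have sub: "dstates Q \<subseteq> mk ` T"
  proof
    fix s assume "s \<in> dstates Q"
    then have "(reach s, pref s, trace s, marked s, flash s, reset s) \<in> T"
      by (simp add: dstates_def T_def K_def Let_def)
    moreover have "s = mk (reach s, pref s, trace s, marked s, flash s, reset s)"
      by (simp add: mk_def)
    ultimately show "s \<in> mk ` T" by (metis imageI)
  qed
  then show "finite (dstates Q)" using finT by (meson finite_imageI finite_subset)
  have "card (dstates Q) \<le> card T"
    using sub finT by (meson card_image_le card_mono finite_imageI le_trans)
  also have "card T = 2 ^ (5 * card Q * card Q + 5 * card Q)"
    using assms by (simp add: T_def K_def card_Pow card_cartesian_product flip: power_add)
  finally show "card (dstates Q) \<le> \<dots>" .
qed

lemma start_in_dstates: "I \<subseteq> Q \<Longrightarrow> start (2 * card Q) I \<in> dstates Q"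
  by (auto simp: start_def dstates_def Let_def)

lemma step_in_dstates:
  assumes "R \<subseteq> Q \<times> Q"
  shows "step (2 * card Q) F R s \<in> dstates Q"
  using assms
  by (auto simp: step_def dstates_def Let_def kept_def flashing_def remark_def moved_def children_def)

text \<open>A best predecessor exists because a rank function makes the preorder total, so that the
  maximum over the finitely many predecessors is attained.\<close>

lemma parent_if_ranked:
  fixes rk :: "'q \<Rightarrow> nat"
  assumes fin: "finite (reach s)" and y: "y \<in> R `` reach s"
    and pref: "pref s = {(x, y). x \<in> reach s \<and> y \<in> reach s \<and> rk y \<le> rk x}"
  shows "parent s R y \<in> reach s" "(parent s R y, y) \<in> R"
    "\<And>x. x \<in> reach s \<Longrightarrow> (x, y) \<in> R \<Longrightarrow> rk x \<le> rk (parent s R y)"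
proof -
  define X where "X = {x \<in> reach s. (x, y) \<in> R}"
  have X: "finite (rk ` X)" "rk ` X \<noteq> {}" using fin y by (auto simp: X_def)
  obtain x where x: "x \<in> X" "rk x = Max (rk ` X)" using Max_in[OF X] by auto
  have "\<exists>x. x \<in> reach s \<and> (x, y) \<in> R \<and> (\<forall>x'\<in>reach s. (x', y) \<in> R \<longrightarrow> (x, x') \<in> pref s)"
    using x Max_ge[OF X(1)] by (intro exI[of _ x]) (auto simp: X_def pref)
  from someI_ex[OF this]
  have *: "parent s R y \<in> reach s \<and> (parent s R y, y) \<in> R \<and>
     (\<forall>x'\<in>reach s. (x', y) \<in> R \<longrightarrow> (parent s R y, x') \<in> pref s)"
    by (simp add: parent_def)
  then show "parent s R y \<in> reach s" "(parent s R y, y) \<in> R"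
    "\<And>x. x \<in> reach s \<Longrightarrow> (x, y) \<in> R \<Longrightarrow> rk x \<le> rk (parent s R y)"
    by (auto simp: pref)
qed

text \<open>Sets of children are preimages under the parent map, and preimages preserve disjointness
  and inclusion.\<close>

lemma laminar_moved:
  assumes "laminar ((\<lambda>k. trace s `` {k}) ` {..<n})"
  shows "laminar (moved s R ` {..<n})"
  unfolding laminar_def ball_simps
proof (intro ballI)
  fix j k assume "j \<in> {..<n}" "k \<in> {..<n}"
  then have "trace s `` {j} \<inter> trace s `` {k} = {} \<or> trace s `` {j} \<subseteq> trace s `` {k} \<or> trace s `` {k} \<subseteq> trace s `` {j}"
    using assms unfolding laminar_def by blast
  then show "moved s R j \<inter> moved s R k = {} \<or> moved s R j \<subseteq> moved s R k \<or> moved s R k \<subseteq> moved s R j"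
    unfolding moved_def children_def by blast
qed

lemma inj_on_moved_kept: "inj_on (moved s R) (kept n s R)"
  by (rule inj_onI) (auto simp: kept_def, metis linorder_neqE_nat)

text \<open>This is where the number of slots matters: the tracked sets together with all singletons form
  a laminar family, so there are enough free slots.\<close>

lemma refill:
  assumes lam: "laminar ((\<lambda>k. trace s `` {k}) ` {..<n})"
    and fin: "finite (R `` reach s)" and n: "2 * card (R `` reach s) \<le> n"
  shows "(\<forall>k\<in>kept n s R. refill n s R k = moved s R k) \<and>
     (\<forall>k\<in>{..<n} - kept n s R. refill n s R k = {} \<or> (\<exists>y. refill n s R k = {y})) \<and>
     (\<forall>y\<in>R `` reach s. \<exists>k<n. refill n s R k = {y})"
proof -
  let ?S = "R `` reach s" and ?K = "kept n s R" and ?m = "moved s R"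
  \<comment> \<open>The singletons that no kept slot holds yet.\<close>
  define M where "M = (\<lambda>y. {y}) ` ?S - ?m ` ?K"
  have sub: "?K \<subseteq> {..<n}" by (auto simp: kept_def)
  have finK: "finite ?K" using sub by (rule finite_subset) simp
  have "laminar (?m ` ?K)" using laminar_moved[OF lam, of R] sub unfolding laminar_def by blast
  then have "laminar (?m ` ?K \<union> M)" unfolding laminar_def M_def by blast
  moreover have "?m ` ?K \<union> M \<subseteq> Pow ?S - {{}}"
    by (auto simp: M_def kept_def moved_def children_def)
  ultimately have "card (?m ` ?K \<union> M) \<le> n" 
    using n by (blast intro: le_trans laminar_card[OF fin])
  \<comment> \<open>Kept slots hold distinct sets, so the laminar bound counts kept slots plus
    missing singletons; hence the free slots can take the latter.\<close>
  moreover have "card (?m ` ?K \<union> M) = card ?K + card M"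
    using finK fin by (subst card_Un_disjoint) (auto simp: M_def card_image inj_on_moved_kept)
  ultimately have "card M \<le> card ({..<n} - ?K)" using sub finK by (simp add: card_Diff_subset)
  then obtain h where h: "h ` M \<subseteq> {..<n} - ?K" "inj_on h M"
    using card_le_inj[of M "{..<n} - ?K"] fin by (auto simp: M_def)
  define g where "g = (\<lambda>k. if k \<in> ?K then ?m k else if k \<in> h ` M then inv_into M h k else {})"
  have "\<exists>k<n. g k = {y}" if "y \<in> ?S" for y
  proof (cases "{y} \<in> M")
    case True
    then have "h {y} \<in> {..<n} - ?K" "inv_into M h (h {y}) = {y}" using h by auto
    then show ?thesis using True by (intro exI[of _ "h {y}"]) (simp add: g_def)
  next
    case False
    moreover have "{y} \<in> (\<lambda>y. {y}) ` ?S" using that by (rule imageI)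
    ultimately have "{y} \<in> ?m ` ?K" by (simp add: M_def)
    then obtain k where "k \<in> ?K" "?m k = {y}" by (metis imageE)
    then have "k < n" "g k = {y}" using sub by (auto simp: g_def)
    then show ?thesis by blast
  qed
  moreover have "g k = {} \<or> (\<exists>y. g k = {y})" if "k \<notin> ?K" for k
  proof (cases "k \<in> h ` M")
    case True
    then have "g k \<in> M" using that inv_into_into[of k h M] by (simp add: g_def)
    then show ?thesis by (auto simp: M_def)
  qed (use that in \<open>simp add: g_def\<close>)
  moreover have "\<forall>k\<in>?K. g k = ?m k" by (simp add: g_def)
  ultimately have "\<exists>g. (\<forall>k\<in>?K. g k = ?m k) \<and> (\<forall>k\<in>{..<n} - ?K. g k = {} \<or> (\<exists>y. g k = {y})) \<and>
     (\<forall>y\<in>?S. \<exists>k<n. g k = {y})"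
    by (intro exI[of _ g]) blast
  from someI_ex[OF this] show ?thesis unfolding refill_def .
qed

section \<open>The acceptor on a fixed sequence of relations\<close>

locale relation_word =
  fixes Q I F :: "'q set" and R :: "nat \<Rightarrow> ('q \<times> 'q) set"
  assumes finite_Q: "finite Q" and I_subset: "I \<subseteq> Q" and R_subset: "\<And>i. R i \<subseteq> Q \<times> Q"
begin

definition n :: nat where "n = 2 * card Q"

primrec st :: "nat \<Rightarrow> 'q dstate" where
  "st 0 = start n I"
| "st (Suc i) = step n F (R i) (st i)"

abbreviation "S i \<equiv> reach (st i)"
abbreviation "par i \<equiv> parent (st i) (R i)"
abbreviation "D i k \<equiv> trace (st i) `` {k}"

text \<open>A numerical representation of the preorder \<open>pref (st i)\<close>; the acceptor itself cannot store
  the rank, which is unbounded.\<close>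

primrec rk :: "nat \<Rightarrow> 'q \<Rightarrow> nat" where
  "rk 0 x = 0"
| "rk (Suc i) y = 2 * rk i (par i y) + (if y \<in> F then 1 else 0)"

declare st.simps [simp del]

lemma S_0 [simp]: "S 0 = I" by (simp add: start_def st.simps)

lemma S_Suc: "S (Suc i) = R i `` S i" by (simp add: step_def st.simps)

lemma S_subset: "S i \<subseteq> Q"
  by (induction i) (use I_subset R_subset in \<open>auto simp: S_Suc\<close>)

lemma finite_S: "finite (S i)" using S_subset finite_Q finite_subset by blast

text \<open>Acceptance adds only 1 to twice the rank of the parent, so comparing ranks means
  comparing parents first and acceptance second, as in \<open>step\<close>.\<close>

lemma pref_st: "pref (st i) = {(x, y). x \<in> S i \<and> y \<in> S i \<and> rk i y \<le> rk i x}"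
proof (induction i)
  case 0
  then show ?case by (auto simp: start_def st.simps)
next
  case (Suc i)
  have "par i x \<in> S i" if "x \<in> R i `` S i" for x
    using parent_if_ranked(1)[OF finite_S that Suc] .
  then show ?case by (auto simp: step_def st.simps Suc)
qed

lemma par:
  assumes "y \<in> S (Suc i)"
  shows "par i y \<in> S i" "(par i y, y) \<in> R i"
    "\<And>x. x \<in> S i \<Longrightarrow> (x, y) \<in> R i \<Longrightarrow> rk i x \<le> rk i (par i y)"
  using parent_if_ranked[OF finite_S _ pref_st, of y "R i" i] assms by (auto simp: S_Suc)

text \<open>Laminarity of level \<open>i\<close> is a hypothesis here because
  \<open>laminar_D\<close> is proved by an induction that uses these facts.\<close>

lemma trace_Suc:
  assumes lam: "laminar ((\<lambda>k. D i k) ` {..<n})"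
  shows D_kept_aux: "\<And>k. k \<in> kept n (st i) (R i) \<Longrightarrow> D (Suc i) k = moved (st i) (R i) k"
    and D_free_aux: "\<And>k. k < n \<Longrightarrow> k \<notin> kept n (st i) (R i) \<Longrightarrow> D (Suc i) k = {} \<or> (\<exists>y. D (Suc i) k = {y})"
    and D_singleton_aux: "\<And>y. y \<in> S (Suc i) \<Longrightarrow> \<exists>k<n. D (Suc i) k = {y}"
proof -
  have n: "2 * card (R i `` S i) \<le> n"
    using card_mono[OF finite_Q S_subset[of "Suc i"]] by (simp add: n_def S_Suc)
  note refill = refill[OF lam finite_S[of "Suc i", unfolded S_Suc] n]
  note r1 = refill[THEN conjunct1] and r2 = refill[THEN conjunct2, THEN conjunct1]
    and r3 = refill[THEN conjunct2, THEN conjunct2]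
  have D: "D (Suc i) k = refill n (st i) (R i) k \<inter> R i `` S i" if "k < n" for k
    using that by (auto simp: step_def st.simps)
  show "D (Suc i) k = moved (st i) (R i) k" if "k \<in> kept n (st i) (R i)" for k
  proof -
    have "k < n" using that by (simp add: kept_def)
    moreover have "moved (st i) (R i) k \<subseteq> R i `` S i" by (auto simp: moved_def children_def)
    ultimately show ?thesis using bspec[OF r1 that] D[of k] by auto
  qed
  show "D (Suc i) k = {} \<or> (\<exists>y. D (Suc i) k = {y})" if "k < n" "k \<notin> kept n (st i) (R i)" for k
  proof -
    have "refill n (st i) (R i) k = {} \<or> (\<exists>y. refill n (st i) (R i) k = {y})"
      using r2 that by simp
    then show ?thesis using D[OF that(1)] by auto
  qed
  show "\<exists>k<n. D (Suc i) k = {y}" if y: "y \<in> S (Suc i)" for y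
  proof -
    obtain k where "k < n" "refill n (st i) (R i) k = {y}" using bspec[OF r3 y[unfolded S_Suc]] by blast
    then show ?thesis using D[of k] y unfolding S_Suc by (intro exI[of _ k]) auto
  qed
qed

text \<open>Kept slots inherit laminarity from the previous level; every other slot is empty or a
  singleton, which no set can properly cross.\<close>

lemma laminar_D: "laminar ((\<lambda>k. D i k) ` {..<n})"
proof (induction i)
  case 0
  then show ?case by (simp add: start_def st.simps laminar_def)
next
  case (Suc i)
  show ?case
    unfolding laminar_def ball_simps
  proof (intro ballI)
    fix j k assume jk: "j \<in> {..<n}" "k \<in> {..<n}"
    show "D (Suc i) j \<inter> D (Suc i) k = {} \<or> D (Suc i) j \<subseteq> D (Suc i) k \<or> D (Suc i) k \<subseteq> D (Suc i) j"
    proof (cases "j \<in> kept n (st i) (R i) \<and> k \<in> kept n (st i) (R i)")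
      case True
      then show ?thesis
        using laminarD[OF laminar_moved[OF Suc, of "R i"] imageI[OF jk(1)] imageI[OF jk(2)]]
        by (simp add: D_kept_aux[OF Suc])
    next
      case False
      then consider "j \<notin> kept n (st i) (R i)" | "k \<notin> kept n (st i) (R i)" by blast
      then show ?thesis
      proof cases
        case 1
        with jk have "D (Suc i) j = {} \<or> (\<exists>y. D (Suc i) j = {y})" by (intro D_free_aux[OF Suc]) simp_all
        then show ?thesis by (elim disjE exE) simp_all
      next
        case 2
        with jk have "D (Suc i) k = {} \<or> (\<exists>y. D (Suc i) k = {y})" by (intro D_free_aux[OF Suc]) simp_all
        then show ?thesis by (elim disjE exE) simp_all
      qed
    qed
  qed
qed

lemmas D_kept = D_kept_aux[OF laminar_D] and D_singleton = D_singleton_aux[OF laminar_D]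

lemma marked_Suc:
  "marked (st (Suc i)) `` {k} =
    (if k \<in> kept n (st i) (R i) - flash (st (Suc i)) then remark F (st i) (R i) k else {})"
  by (auto simp: step_def st.simps)

lemma flash_Suc:
  "k \<in> flash (st (Suc i)) \<longleftrightarrow> k \<in> kept n (st i) (R i) \<and> remark F (st i) (R i) k = moved (st i) (R i) k"
  by (simp add: step_def st.simps flashing_def)

lemma reset_Suc: "k \<in> reset (st (Suc i)) \<longleftrightarrow> k < n \<and> k \<notin> kept n (st i) (R i)"
  by (simp add: step_def st.simps)

lemma moved_eq: "moved (st i) (R i) k = {y \<in> S (Suc i). par i y \<in> D i k}"
  by (simp add: moved_def children_def S_Suc)

section \<open>From a flashing slot to an accepting run\<close>

lemma path_to_reach:
  "x \<in> S i \<Longrightarrow> \<exists>r. r 0 \<in> I \<and> (\<forall>j<i. (r j, r (Suc j)) \<in> R j) \<and> r i = x"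
proof (induction i arbitrary: x)
  case 0
  then show ?case by (intro exI[of _ "\<lambda>_. x"]) simp
next
  case (Suc i)
  then obtain z where z: "z \<in> S i" "(z, x) \<in> R i" unfolding S_Suc by blast
  obtain r where "r 0 \<in> I" "\<forall>j<i. (r j, r (Suc j)) \<in> R j" "r i = z" using Suc.IH[OF z(1)] by blast
  then show ?case using z(2) by (intro exI[of _ "r(Suc i := x)"]) (auto simp: less_Suc_eq)
qed

definition accepting_run :: "(nat \<Rightarrow> 'q) \<Rightarrow> bool" where
  "accepting_run r \<longleftrightarrow> r 0 \<in> I \<and> (\<forall>i. (r i, r (Suc i)) \<in> R i) \<and> (\<exists>\<^sub>\<infinity>i. r i \<in> F)"

text \<open>After its last reset the slot holds finite nonempty sets closed under parents, so
  Koenig's lemma gives a branch inside it. Between two flashes every member, hence the branch, must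
  pass an accepting location.\<close>

lemma accepting_run_if_flashing:
  assumes fl: "\<exists>\<^sub>\<infinity>i. k \<in> flash (st i)" and rs: "\<not> (\<exists>\<^sub>\<infinity>i. k \<in> reset (st i))" and "k < n"
  shows "\<exists>r. accepting_run r"
proof -
  obtain m where m: "\<And>i. i > m \<Longrightarrow> k \<notin> reset (st i)" using rs unfolding INFM_nat by blast
  have kept: "k \<in> kept n (st i) (R i)" if "i \<ge> m" for i
    using m[of "Suc i"] that \<open>k < n\<close> by (simp add: reset_Suc)
  \<comment> \<open>The shift by one is due to \<open>kept\<close> at step \<open>i\<close>
    describing the set at level \<open>Suc i\<close>.\<close>
  define X where "X = (\<lambda>i. D (Suc m + i) k)"
  have Dm: "D (Suc i) k = {y \<in> S (Suc i). par i y \<in> D i k}" if "i \<ge> m" for i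
    using D_kept[OF kept[OF that]] moved_eq by simp
  have "\<exists>b. \<forall>i. b i \<in> X i \<and> par (Suc m + i) (b (Suc i)) = b i"
  proof (rule koenig)
    show "finite (X i)" for i
      using Dm[of "m + i"] finite_S[of "Suc (m + i)"] by (simp add: X_def)
    show "X i \<noteq> {}" for i
      using D_kept[OF kept[of "m + i"]] kept[of "m + i"] by (auto simp: X_def kept_def)
    show "par (Suc m + i) x \<in> X i" if "x \<in> X (Suc i)" for x i
      using that Dm[of "Suc m + i"] by (auto simp: X_def)
  qed
  then obtain b where b: "\<And>i. b i \<in> X i" "\<And>i. par (Suc m + i) (b (Suc i)) = b i" by blast
  have bS: "b i \<in> S (Suc m + i)" for i using b(1)[of i] Dm[of "m + i"] by (simp add: X_def)
  obtain r where r: "r 0 \<in> I" "\<And>j. j < Suc m \<Longrightarrow> (r j, r (Suc j)) \<in> R j" "r (Suc m) = b 0"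
    using path_to_reach[OF bS[of 0]] by auto
  \<comment> \<open>A finite path from an initial location to \<open>b 0\<close>, continued by the
    branch.\<close>
  define c where "c = (\<lambda>j. if j < Suc m then r j else b (j - Suc m))"
  have c: "c j \<in> D j k" "par j (c (Suc j)) = c j" "c (Suc j) \<in> S (Suc j)" if jm: "j \<ge> Suc m" for j
  proof -
    obtain d where d: "j = Suc m + d" using le_Suc_ex[OF jm] by blast
    have "j - Suc m = d" "Suc j - Suc m = Suc d" using d by simp_all
    then have "c j = b d" "c (Suc j) = b (Suc d)" using d by (simp_all add: c_def)
    then show "c j \<in> D j k" "par j (c (Suc j)) = c j" "c (Suc j) \<in> S (Suc j)"
      using b[of d] bS[of "Suc d"] d by (simp_all add: X_def)
  qed
  have "(c j, c (Suc j)) \<in> R j" for j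
  proof -
    consider "Suc j < Suc m" | "j = m" | "j \<ge> Suc m" by linarith
    then show ?thesis
    proof cases
      case 3 then show ?thesis using par(2)[OF c(3)] c(2) by simp
    qed (use r(2)[of j] r(3) in \<open>auto simp: c_def\<close>)
  qed
  moreover have "\<exists>\<^sub>\<infinity>i. c i \<in> F"
  proof (rule ccontr)
    assume "\<not> (\<exists>\<^sub>\<infinity>i. c i \<in> F)"
    then obtain N where N: "\<And>i. i > N \<Longrightarrow> c i \<notin> F" unfolding INFM_nat by blast
    have flash: "\<exists>t. t \<ge> N' \<and> k \<in> flash (st (Suc t))" for N'
      using fl unfolding INFM_nat by (metis Suc_lessE less_imp_le_nat less_Suc_eq_le)
    obtain t where t: "t \<ge> N + Suc m" "k \<in> flash (st (Suc t))" using flash by blast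
    \<comment> \<open>Past the last accepting visit a mark can only be inherited. A flash clears all
      marks, so the branch stays unmarked and blocks the next flash.\<close>
    have nrm: "c (Suc i) \<notin> remark F (st i) (R i) k" if "c i \<notin> marked (st i) `` {k}" "i > t" for i
      using that N[of "Suc i"] c(2)[of i] t by (auto simp: remark_def)
    have unmarked: "c i \<notin> marked (st i) `` {k}" if "i \<ge> Suc t" for i
      using that
    proof (induction i rule: dec_induct)
      case base
      then show ?case using t(2) by (simp add: marked_Suc)
    next
      case (step i)
      then show ?case using nrm[of i] by (simp add: marked_Suc)
    qed
    obtain t' where t': "t' \<ge> Suc t" "k \<in> flash (st (Suc t'))" using flash by blast
    have "c (Suc t') \<in> moved (st t') (R t') k"
      using c(1)[of "Suc t'"] t t' D_kept[OF kept[of t']] by simp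
    then show False using nrm[OF unmarked, of t'] t' by (simp add: flash_Suc)
  qed
  moreover have "c 0 \<in> I" using r(1) by (simp add: c_def)
  ultimately show ?thesis unfolding accepting_run_def by blast
qed

section \<open>From an accepting run to a flashing slot\<close>

lemma run_reach:
  assumes "r 0 \<in> I" "\<And>i. (r i, r (Suc i)) \<in> R i"
  shows "r i \<in> S i"
  by (induction i) (use assms in \<open>auto simp: S_Suc\<close>)

text \<open>The branch need not follow the given run; the maximality of its ranks is what forces
  accepting visits on it.\<close>

lemma greedy_branch:
  assumes "accepting_run r"
  shows "\<exists>b. (\<forall>i. b i \<in> S i \<and> par i (b (Suc i)) = b i) \<and> (\<exists>\<^sub>\<infinity>i. b i \<in> F)"
proof -
  \<comment> \<open>\<open>A i\<close> collects the reachable locations that start an accepting path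
    at level \<open>i\<close>, and \<open>C i\<close> those of maximal rank among them.\<close>
  define path where "path = (\<lambda>i r. (\<forall>j\<ge>i. (r j, r (Suc j)) \<in> R j) \<and> (\<exists>\<^sub>\<infinity>j. r j \<in> F))"
  define A where "A = (\<lambda>i. {x \<in> S i. \<exists>r. path i r \<and> r i = x})"
  define C where "C = (\<lambda>i. {x \<in> A i. \<forall>y\<in>A i. rk i y \<le> rk i x})"
  have A_pred: "x \<in> A i" if xy: "x \<in> S i" "(x, y) \<in> R i" "y \<in> A (Suc i)" for i x y
  proof -
    obtain r where r: "path (Suc i) r" "r (Suc i) = y" using xy(3) by (auto simp: A_def)
    define r' where "r' = r(i := x)"
    have "(r' j, r' (Suc j)) \<in> R j" if "j \<ge> i" for j
      using r xy(2) that by (cases "j = i") (auto simp: path_def r'_def)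
    moreover have "\<exists>\<^sub>\<infinity>j. r' j \<in> F"
      using r(1) unfolding path_def INFM_nat r'_def
      by (metis fun_upd_apply less_irrefl max_less_iff_conj)
    ultimately show ?thesis using xy(1) unfolding A_def path_def
      by (auto intro!: exI[of _ r'] simp: r'_def)
  qed
  have A_path: "r (Suc j) \<in> A (Suc j)" if "path i r" "j \<ge> i" "r j \<in> S j" for i r j
    using that unfolding A_def path_def by (auto simp: S_Suc intro!: exI[of _ r])
  have finA: "finite (A i)" for i using finite_S by (simp add: A_def)
  have neA: "A i \<noteq> {}" for i
    using run_reach[of r i] assms by (auto simp: A_def path_def accepting_run_def)
  have neC: "C i \<noteq> {}" for i
  proof -
    have "finite (rk i ` A i)" "rk i ` A i \<noteq> {}" using finA neA by auto
    from Max_in[OF this] Max_ge[OF this(1)] show ?thesis by (fastforce simp: C_def)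
  qed
  have succ: "\<exists>y\<in>A (Suc i). (x, y) \<in> R i" if "x \<in> A i" for i x
    using that A_path[of i _ i] by (fastforce simp: A_def path_def)
  have parA: "par i y \<in> A i" if "y \<in> A (Suc i)" for i y
    using A_pred[of "par i y" i y] par[of y i] that by (auto simp: A_def)
  \<comment> \<open>Any \<open>x\<close> in \<open>A i\<close> has a successor \<open>z\<close> in
    \<open>A (Suc i)\<close>. Then twice the rank of \<open>x\<close> is at most the rank of
    \<open>z\<close>, hence of \<open>y\<close>, which is at most twice the rank of the parent of
    \<open>y\<close> plus 1; the 1 disappears on halving.\<close>
  have parC: "par i y \<in> C i" if y: "y \<in> C (Suc i)" for i y
  proof -
    have yA: "y \<in> A (Suc i)" using y by (simp add: C_def)
    have "rk i x \<le> rk i (par i y)" if x: "x \<in> A i" for x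
    proof -
      obtain z where z: "z \<in> A (Suc i)" "(x, z) \<in> R i" using succ[OF x] by blast
      have "rk i x \<le> rk i (par i z)" using par(3)[of z i x] z x by (auto simp: A_def)
      moreover have "rk (Suc i) z \<le> rk (Suc i) y" using y z by (simp add: C_def)
      ultimately show ?thesis by (simp split: if_splits)
    qed
    then show ?thesis using parA[OF yA] by (simp add: C_def)
  qed
  have "\<exists>b. \<forall>i. b i \<in> C i \<and> par i (b (Suc i)) = b i"
    using finA neC parC by (intro koenig) (auto simp: C_def)
  then obtain b where b: "\<And>i. b i \<in> C i" "\<And>i. par i (b (Suc i)) = b i" by blast
  have "\<exists>\<^sub>\<infinity>i. b i \<in> F"
  proof (rule ccontr)
    assume "\<not> (\<exists>\<^sub>\<infinity>i. b i \<in> F)"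
    then obtain m where m: "\<And>i. i > m \<Longrightarrow> b i \<notin> F" unfolding INFM_nat by blast
    obtain r where r: "path m r" "r m = b m" using b(1)[of m] by (auto simp: C_def A_def)
    \<comment> \<open>While the branch avoids accepting locations its rank exactly doubles. The rank
      along \<open>r\<close> at least doubles and may not exceed the maximum held by the branch, so
      \<open>r\<close> avoids them too.\<close>
    have rC: "r i \<in> C i \<and> (i > m \<longrightarrow> r i \<notin> F)" if "i \<ge> m" for i
      using that
    proof (induction i rule: dec_induct)
      case base
      then show ?case using r b by simp
    next
      case (step i)
      then have ri: "r i \<in> C i" by simp
      have e: "(r i, r (Suc i)) \<in> R i" using r(1) step(1) by (simp add: path_def)
      have rS: "r i \<in> S i" using ri by (simp add: C_def A_def)
      have rA: "r (Suc i) \<in> A (Suc i)" using A_path[OF r(1) step(1) rS] .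
      have "rk i (r i) \<le> rk i (par i (r (Suc i)))"
        using par(3)[OF _ rS e] rA by (simp add: A_def)
      moreover have "rk i (b i) \<le> rk i (r i)" using b(1)[of i] ri by (simp add: C_def)
      moreover have "rk (Suc i) (r (Suc i)) \<le> rk (Suc i) (b (Suc i))" using b(1)[of "Suc i"] rA by (simp add: C_def)
      moreover have "b (Suc i) \<notin> F" using m step(1) by simp
      ultimately have "rk (Suc i) (r (Suc i)) = rk (Suc i) (b (Suc i)) \<and> r (Suc i) \<notin> F"
        using b(2)[of i] by (simp split: if_splits)
      then show ?case using rA b(1)[of "Suc i"] by (simp add: C_def del: rk.simps)
    qed
    then show False using r(1) unfolding path_def INFM_nat by (meson less_imp_le_nat)
  qed
  then show ?thesis using b by (auto simp: C_def A_def)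
qed

text \<open>The slot is the one that finally holds the descendants of some \<open>b m\<close>,
  chosen so late that for each \<open>t \<ge> m\<close> they all eventually descend from
  \<open>b t\<close>. An accepting \<open>b t\<close> marks its descendants, and once these fill the
  slot it flashes.\<close>

lemma flashing_if_branch:
  assumes b: "\<And>i. b i \<in> S i" "\<And>i. par i (b (Suc i)) = b i" and bF: "\<exists>\<^sub>\<infinity>i. b i \<in> F"
  shows "\<exists>k<n. (\<exists>\<^sub>\<infinity>i. k \<in> flash (st i)) \<and> \<not> (\<exists>\<^sub>\<infinity>i. k \<in> reset (st i))"
proof -
  \<comment> \<open>\<open>E m j\<close> is the set of descendants of \<open>b m\<close> at level \<open>j\<close>, and empty for \<open>j < m\<close>.\<close>
  define E where "E = (\<lambda>m. rec_nat (if m = 0 then {b 0} else {})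
    (\<lambda>j X. if Suc j = m then {b m} else children (st j) (R j) X))"
  have E0: "E m 0 = (if m = 0 then {b 0} else {})"
    and ES: "E m (Suc j) = (if Suc j = m then {b m} else {y \<in> S (Suc j). par j y \<in> E m j})" for m j
    by (simp_all add: E_def children_def S_Suc)
  have Em: "E m m = {b m}" for m by (cases m) (simp_all add: E0 ES)
  have E_less: "E m j = {}" if "j < m" for m j
    using that by (induction j) (auto simp: E0 ES)
  have E_S: "E m j \<subseteq> S j" for m j using b(1)[of 0] b(1)[of m] by (cases j) (auto simp: E0 ES)
  have bE: "b j \<in> E m j" if "m \<le> j" for m j
    using that by (induction j rule: dec_induct) (auto simp: Em ES b)
  have E_mono: "E t j \<subseteq> E m j" if "m \<le> t" for m t j
  proof (induction j)
    case 0
    then show ?case using that by (auto simp: E0)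
  next
    case (Suc j)
    consider "Suc j < t" | "Suc j = t" | "Suc j > t" by linarith
    then show ?case
    proof cases
      case 1 then show ?thesis by (simp add: E_less)
    next
      case 2 then show ?thesis using Em[of t] bE[OF that] by simp
    next
      case 3 then show ?thesis using Suc that by (auto simp: ES)
    qed
  qed
  \<comment> \<open>From some level on, all side branches die out: otherwise there would be arbitrarily long strictly
    decreasing chains of subsets of \<open>Q\<close>.\<close>
  have "\<exists>m\<ge>1. \<forall>t\<ge>m. \<exists>j\<ge>t. E m j = E t j"
  proof (rule ccontr)
    assume "\<not> ?thesis"
    then have neg: "\<exists>t\<ge>m. \<forall>j\<ge>t. E m j \<noteq> E t j" if "m \<ge> 1" for m using that by blast
    \<comment> \<open>Each further link of the chain loses at least one location at every later
      level, so \<open>Suc (card Q)\<close> links are too many.\<close>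
    have "\<exists>t\<ge>1. \<forall>j\<ge>t. d + card (E t j) \<le> card (E 1 j)" for d
    proof (induction d)
      case 0
      then show ?case by (intro exI[of _ 1]) simp
    next
      case (Suc d)
      then obtain t where t: "t \<ge> 1" "\<And>j. j \<ge> t \<Longrightarrow> d + card (E t j) \<le> card (E 1 j)" by blast
      obtain t' where t': "t' \<ge> t" "\<And>j. j \<ge> t' \<Longrightarrow> E t j \<noteq> E t' j" using neg[OF t(1)] by blast
      have "Suc d + card (E t' j) \<le> card (E 1 j)" if "j \<ge> t'" for j
      proof -
        have "E t' j \<subset> E t j" using E_mono[OF t'(1)] t'(2)[OF that] by blast
        then have "card (E t' j) < card (E t j)"
          using finite_S E_S finite_subset by (metis psubset_card_mono)
        then show ?thesis using t(2)[of j] that t'(1) by simp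
      qed
      then show ?case using t t' by (intro exI[of _ t']) auto
    qed
    then obtain t where "Suc (card Q) + card (E t t) \<le> card (E 1 t)" by blast
    moreover have "card (E 1 t) \<le> card Q"
      using E_S S_subset by (intro card_mono[OF finite_Q]) blast
    ultimately show False by simp
  qed
  then obtain m where m: "m \<ge> 1" "\<And>t. t \<ge> m \<Longrightarrow> \<exists>j\<ge>t. E m j = E t j" by blast
  define slot where "slot = (\<lambda>i k. k < n \<and> D i k = E m i)"
  have moved_slot: "moved (st i) (R i) k = E m (Suc i)" if "i \<ge> m" "D i k = E m i" for i k
    using that by (simp add: moved_eq ES)
  \<comment> \<open>Of all slots about to hold this set, the one of least index is kept.\<close>
  have keep: "\<exists>k'\<le>k. k' \<in> kept n (st i) (R i) \<and> slot (Suc i) k'" if i: "i \<ge> m" and k: "k < n" "moved (st i) (R i) k = E m (Suc i)" for i k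
  proof -
    define k' where "k' = (LEAST k. moved (st i) (R i) k = E m (Suc i))"
    have k': "moved (st i) (R i) k' = E m (Suc i)" "k' \<le> k" "\<And>j. j < k' \<Longrightarrow> moved (st i) (R i) j \<noteq> E m (Suc i)"
      using LeastI[where P = "\<lambda>k. moved (st i) (R i) k = E m (Suc i)", OF k(2)]
        Least_le[where P = "\<lambda>k. moved (st i) (R i) k = E m (Suc i)", OF k(2)]
        not_less_Least[where P = "\<lambda>k. moved (st i) (R i) k = E m (Suc i)"]
      unfolding k'_def by blast+
    then have "k' \<in> kept n (st i) (R i)" using k bE[of m "Suc i"] i by (auto simp: kept_def)
    then have "D (Suc i) k' = E m (Suc i)" using k'(1) D_kept by blast
    then show ?thesis using k'(2) k(1) \<open>k' \<in> kept n (st i) (R i)\<close> by (auto simp: slot_def)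
  qed
  have ex_slot: "\<exists>k. slot i k" if "i \<ge> m" for i
    using that
  proof (induction i rule: dec_induct)
    case base
    \<comment> \<open>This is where \<open>m \<ge> 1\<close> matters: singletons are not tracked at
      level 0.\<close>
    obtain m' where "m = Suc m'" using m(1) by (cases m) auto
    then show ?case using D_singleton[OF b(1)[of "Suc m'"]] Em[of m] by (auto simp: slot_def)
  next
    case (step i)
    then obtain k where "slot i k" by blast
    then show ?case using keep[OF step(1), of k] moved_slot[OF step(1), of k] by (auto simp: slot_def)
  qed
  \<comment> \<open>Merging only moves the descendants of \<open>b m\<close> to a smaller slot, so the minimal slot they ever
    occupy is final.\<close>
  obtain i0 k where k: "i0 \<ge> m" "slot i0 k" and min: "\<And>i j. i \<ge> m \<Longrightarrow> slot i j \<Longrightarrow> k \<le> j"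
  proof -
    define k where "k = (LEAST k. \<exists>i\<ge>m. slot i k)"
    have "\<exists>i\<ge>m. slot i k" unfolding k_def by (rule LeastI_ex) (use ex_slot in blast)
    moreover have "k \<le> j" if "i \<ge> m" "slot i j" for i j
      unfolding k_def using that by (intro Least_le) blast
    ultimately show thesis using that by blast
  qed
  have stable: "slot i k \<and> k \<in> kept n (st i) (R i)" if "i \<ge> i0" for i
  proof -
    have *: "slot (Suc i) k \<and> k \<in> kept n (st i) (R i)" if i: "i \<ge> i0" "slot i k" for i
    proof -
      have "i \<ge> m" using i k(1) by simp
      then obtain k' where "k' \<le> k" "k' \<in> kept n (st i) (R i)" "slot (Suc i) k'"
        using keep[of i k] moved_slot[of i k] i(2) by (auto simp: slot_def)
      then show ?thesis using min[of "Suc i" k'] \<open>i \<ge> m\<close> by fastforce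
    qed
    have "slot i k" using that by (induction i rule: dec_induct) (use k * in auto)
    then show ?thesis using * that by blast
  qed
  have "k \<notin> reset (st i)" if "i > i0" for i
    using that stable[of "i - 1"] by (cases i) (auto simp: reset_Suc)
  then have "\<not> (\<exists>\<^sub>\<infinity>i. k \<in> reset (st i))" unfolding INFM_nat by blast
  moreover have "\<exists>\<^sub>\<infinity>i. k \<in> flash (st i)"
  proof (rule ccontr)
    assume "\<not> ?thesis"
    then obtain i1 where i1: "\<And>i. i > i1 \<Longrightarrow> k \<notin> flash (st i)" unfolding INFM_nat by blast
    obtain t where t: "t > Suc (i0 + i1)" "b t \<in> F" using bF unfolding INFM_nat by blast
    have marked: "marked (st (Suc i)) `` {k} = remark F (st i) (R i) k" if "i \<ge> i0 + i1" for i
      using that stable[of i] i1[of "Suc i"] by (simp add: marked_Suc)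
    have D_E: "D i k = E m i" if "i \<ge> i0" for i using stable[OF that] by (simp add: slot_def)
    have moved_E: "moved (st i) (R i) k = E m (Suc i)" if "i \<ge> i0" for i
      using moved_slot[of i k] D_E[OF that] that k(1) by simp
    \<comment> \<open>From the accepting \<open>b t\<close> on, its descendants inherit the mark,
      and by assumption no flash clears it.\<close>
    have sub: "E t i \<subseteq> marked (st i) `` {k}" if "i \<ge> t" for i
      using that
    proof (induction i rule: dec_induct)
      case base
      obtain t' where t': "t = Suc t'" using t by (cases t) auto
      have "b t \<in> remark F (st t') (R t') k"
        using t t' moved_E[of t'] bE[of m t] k(1) by (auto simp: remark_def)
      then show ?case using marked[of t'] t t' by (simp add: Em)
    next
      case (step i)
      have "E t (Suc i) \<subseteq> remark F (st i) (R i) k"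
        using step moved_E[of i] t E_mono[of m t "Suc i"] k(1) by (auto simp: remark_def ES)
      then show ?case using marked[of i] step t by simp
    qed
    \<comment> \<open>At level \<open>j\<close> the whole slot consists of descendants of
      \<open>b t\<close>, hence is marked, and must flash.\<close>
    obtain j where j: "j \<ge> t" "E m j = E t j" using m(2)[of t] t k(1) by auto
    obtain j' where j': "j = Suc j'" using j t by (cases j) auto
    have "remark F (st j') (R j') k = moved (st j') (R j') k"
      using sub[OF j(1)] j marked[of j'] moved_E[of j'] t unfolding j' by (auto simp: remark_def)
    then show False using i1[of j] stable[of j'] j t unfolding j' by (simp add: flash_Suc)
  qed
  ultimately show ?thesis using k(2) by (auto simp: slot_def)
qed

theorem accepting_run_iff_flashing:
  "(\<exists>r. accepting_run r) \<longleftrightarrow> (\<exists>k<n. (\<exists>\<^sub>\<infinity>i. k \<in> flash (st i)) \<and> \<not> (\<exists>\<^sub>\<infinity>i. k \<in> reset (st i)))"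
  using accepting_run_if_flashing greedy_branch flashing_if_branch by blast

end

section \<open>Types\<close>

lemma holds_conj: "holds z z' (foldr And fs TT) \<longleftrightarrow> (\<forall>f\<in>set fs. holds z z' f)"
  by (induction fs) auto

lemma atoms_conj: "atoms (foldr And fs TT) = (\<Union>f\<in>set fs. atoms f)"
  by (induction fs) auto

lemma set_ordered_pairs: "set (ordered_pairs zs) = {(zs ! i, zs ! j) | i j. i < j \<and> j < length zs}"
  by (fastforce simp: ordered_pairs_def)

lemma ordered_pairs_total:
  assumes "s \<in> set zs" "t \<in> set zs"
  shows "s = t \<or> (s, t) \<in> set (ordered_pairs zs) \<or> (t, s) \<in> set (ordered_pairs zs)"
proof -
  obtain i j where "i < length zs" "j < length zs" "s = zs ! i" "t = zs ! j"
    using assms by (auto simp: in_set_conv_nth)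
  then show ?thesis unfolding set_ordered_pairs by (cases i j rule: linorder_cases) auto
qed

lemma length_ordered_pairs: "2 * length (ordered_pairs zs) + length zs = (length zs)\<^sup>2"
proof -
  have "length (ordered_pairs zs) = (\<Sum>j<length zs. j)"
    by (simp add: ordered_pairs_def length_concat comp_def interv_sum_list_conv_sum_set_nat atLeast0LessThan)
  moreover have "2 * (\<Sum>j<m. j) + m = m\<^sup>2" for m :: nat
    by (induction m) (auto simp: power2_eq_square)
  ultimately show ?thesis by simp
qed

lemma length_cterms: "length (cterms \<beta>) = 2 * \<beta>"
  by (simp add: cterms_def)

section \<open>The unique type of a pair of valuations\<close>

definition const_lit :: "int \<Rightarrow> int \<Rightarrow> int list \<Rightarrow> int list \<Rightarrow> cterm \<Rightarrow> constr" where
  "const_lit d1 d\<alpha> z z' t = (if tval z z' t < d1 then Atom (LtC t d1)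
     else if tval z z' t > d\<alpha> then Atom (GtC t d\<alpha>) else Atom (EqC t (tval z z' t)))"

definition rel_lit :: "int list \<Rightarrow> int list \<Rightarrow> cterm \<times> cterm \<Rightarrow> constr" where
  "rel_lit z z' = (\<lambda>(s, t). if tval z z' s < tval z z' t then Atom (Lt s t)
     else if tval z z' s = tval z z' t then Atom (Eq s t) else Atom (Lt t s))"

definition type_of :: "int \<Rightarrow> int \<Rightarrow> cterm list \<Rightarrow> int list \<Rightarrow> int list \<Rightarrow> constr" where
  "type_of d1 d\<alpha> zs z z' =
    foldr And (map (const_lit d1 d\<alpha> z z') zs @ map (rel_lit z z') (ordered_pairs zs)) TT"

text \<open>The literals for one term exclude each other; \<open>d1 \<le> d\<alpha>\<close> keeps a
  value from being both below \<open>d1\<close> and above \<open>d\<alpha>\<close>.\<close>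

lemma const_lit_eq_iff:
  "d1 \<le> d\<alpha> \<Longrightarrow> c \<in> const_lits d1 d\<alpha> t \<Longrightarrow> holds z z' c \<longleftrightarrow> c = const_lit d1 d\<alpha> z z' t"
  by (auto simp: const_lits_def const_lit_def)

lemma rel_lit_eq_iff: "r \<in> rel_lits p \<Longrightarrow> holds z z' r \<longleftrightarrow> r = rel_lit z z' p"
  by (auto simp: rel_lits_def rel_lit_def split: prod.splits if_splits)

lemma const_lit_in: "const_lit d1 d\<alpha> z z' t \<in> const_lits d1 d\<alpha> t"
  by (auto simp: const_lits_def const_lit_def)

lemma rel_lit_in: "rel_lit z z' p \<in> rel_lits p"
  by (auto simp: rel_lits_def rel_lit_def)

lemma rel_lit_eqD:
  assumes "rel_lit z z' (s, t) = rel_lit w w' (s, t)"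
  shows "(tval z z' s < tval z z' t \<longleftrightarrow> tval w w' s < tval w w' t) \<and>
    (tval z z' s = tval z z' t \<longleftrightarrow> tval w w' s = tval w w' t)"
proof -
  have "holds w w' (rel_lit z z' (s, t))"
    unfolding assms using rel_lit_eq_iff[OF rel_lit_in] by blast
  then show ?thesis by (simp add: rel_lit_def split: if_splits)
qed

lemma const_lit_eqD:
  assumes "const_lit d1 d\<alpha> z z' t = const_lit d1 d\<alpha> w w' t" "d1 \<le> d" "d \<le> d\<alpha>"
  shows "tval z z' t = d \<longleftrightarrow> tval w w' t = d"
proof -
  have "d1 \<le> d\<alpha>" using assms by simp
  then have "holds w w' (const_lit d1 d\<alpha> z z' t)"
    unfolding assms(1) using const_lit_eq_iff[OF _ const_lit_in] by blast
  then show ?thesis using assms(2,3) by (simp add: const_lit_def split: if_splits)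
qed

lemma list_all2_choose:
  assumes "list_all2 (\<lambda>x y. x \<in> P y) xs ys" "\<And>x y. x \<in> P y \<Longrightarrow> holds z z' x \<longleftrightarrow> x = g y"
    "\<forall>x\<in>set xs. holds z z' x"
  shows "xs = map g ys"
  using assms by (induction rule: list_all2_induct) auto

text \<open>The valuations force each conjunct separately, and the fixed order of conjuncts turns
  this into equality of formulas.\<close>

lemma holds_type_iff:
  assumes d: "d1 \<le> d\<alpha>" and f: "f \<in> types d1 d\<alpha> zs"
  shows "holds z z' f \<longleftrightarrow> f = type_of d1 d\<alpha> zs z z'"
proof
  obtain cs rs where cr: "f = foldr And (cs @ rs) TT"
    "list_all2 (\<lambda>c z. c \<in> const_lits d1 d\<alpha> z) cs zs"
    "list_all2 (\<lambda>r p. r \<in> rel_lits p) rs (ordered_pairs zs)"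
    using f unfolding types_def by blast
  assume "holds z z' f"
  then have h: "\<forall>f\<in>set cs. holds z z' f" "\<forall>f\<in>set rs. holds z z' f"
    unfolding cr(1) holds_conj by auto
  have "cs = map (const_lit d1 d\<alpha> z z') zs"
    by (rule list_all2_choose[OF cr(2) const_lit_eq_iff[OF d] h(1)])
  moreover have "rs = map (rel_lit z z') (ordered_pairs zs)"
    by (rule list_all2_choose[OF cr(3) rel_lit_eq_iff h(2)])
  ultimately show "f = type_of d1 d\<alpha> zs z z'" using cr(1) by (simp add: type_of_def)
next
  have "holds z z' (const_lit d1 d\<alpha> z z' t)" for t
    using const_lit_eq_iff[OF d const_lit_in] by blast
  moreover have "holds z z' (rel_lit z z' p)" for p
    using rel_lit_eq_iff[OF rel_lit_in] by blast
  moreover assume "f = type_of d1 d\<alpha> zs z z'"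
  ultimately show "holds z z' f" unfolding type_of_def by (simp only: holds_conj) auto
qed

lemma type_of_in_types: "type_of d1 d\<alpha> zs z z' \<in> types d1 d\<alpha> zs"
  unfolding types_def type_of_def
  by (intro CollectI exI[of _ "map (const_lit d1 d\<alpha> z z') zs"]
      exI[of _ "map (rel_lit z z') (ordered_pairs zs)"])
    (simp add: list_all2_conv_all_nth const_lit_in rel_lit_in)

lemma type_of_in_SatTypes:
  assumes "d1 \<le> d\<alpha>" "length z = \<beta>" "length z' = \<beta>"
  shows "type_of d1 d\<alpha> (cterms \<beta>) z z' \<in> SatTypes d1 d\<alpha> \<beta>"
  using assms holds_type_iff[OF assms(1) type_of_in_types] type_of_in_types
  unfolding SatTypes_def by blast

text \<open>Valuations of the same type agree on the order of all terms and on equality with each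
  constant in the interval, hence on every atom of \<open>g\<close>.\<close>

lemma holds_cong_type:
  assumes d: "d1 \<le> d\<alpha>" and f: "f \<in> types d1 d\<alpha> (cterms \<beta>)" and z: "holds z z' f" and w: "holds w w' f"
    and g: "over \<beta> g" "basic g" "\<Union>(atom_consts ` atoms g) \<subseteq> {d1..d\<alpha>}"
  shows "holds z z' g \<longleftrightarrow> holds w w' g"
proof -
  let ?zs = "cterms \<beta>"
  have "type_of d1 d\<alpha> ?zs z z' = type_of d1 d\<alpha> ?zs w w'"
    using z w by (rule trans[OF sym[OF iffD1[OF holds_type_iff[OF d f]]] iffD1[OF holds_type_iff[OF d f]]])
  \<comment> \<open>Equal conjunctions of equally many conjuncts agree conjunct by conjunct.\<close>
  moreover have conj_eq: "xs = ys" if "foldr And xs TT = foldr And ys TT" "length xs = length ys" for xs ys :: "constr list"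
    using that(2,1) by (induction rule: list_induct2) auto
  ultimately have e:
    "map (const_lit d1 d\<alpha> z z') ?zs @ map (rel_lit z z') (ordered_pairs ?zs) =
     map (const_lit d1 d\<alpha> w w') ?zs @ map (rel_lit w w') (ordered_pairs ?zs)"
    unfolding type_of_def by (intro conj_eq) simp_all
  then have c: "const_lit d1 d\<alpha> z z' t = const_lit d1 d\<alpha> w w' t" if "t \<in> set ?zs" for t
    using that by simp
  have r: "rel_lit z z' p = rel_lit w w' p" if "p \<in> set (ordered_pairs ?zs)" for p
    using e that by simp
  have rel: "(tval z z' s < tval z z' t \<longleftrightarrow> tval w w' s < tval w w' t) \<and>
      (tval z z' s = tval z z' t \<longleftrightarrow> tval w w' s = tval w w' t)"
    if st: "s \<in> set ?zs" "t \<in> set ?zs" for s t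
  proof -
    have "(tval z z' s < tval z z' t \<longleftrightarrow> tval w w' s < tval w w' t) \<and>
        (tval z z' s = tval z z' t \<longleftrightarrow> tval w w' s = tval w w' t)"
      if "(s, t) \<in> set (ordered_pairs ?zs)" for s t
      using rel_lit_eqD[OF r[OF that]] .
    note oriented = this
    \<comment> \<open>A type has a literal for one orientation of each pair; the other orientation
      is read off by swapping.\<close>
    have flip: "a < b \<longleftrightarrow> \<not> b < a \<and> b \<noteq> a" "a = b \<longleftrightarrow> b = a" for a b :: int by auto
    from ordered_pairs_total[OF st] show ?thesis
    proof (elim disjE)
      assume "(t, s) \<in> set (ordered_pairs ?zs)"
      from oriented[OF this] show ?thesis
        unfolding flip(1)[of "tval z z' s"] flip(1)[of "tval w w' s"]
          flip(2)[of "tval z z' s"] flip(2)[of "tval w w' s"] by blast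
    qed (use oriented in simp_all)
  qed
  have const: "tval z z' t = d \<longleftrightarrow> tval w w' t = d" if "t \<in> set ?zs" "d1 \<le> d" "d \<le> d\<alpha>" for t d
    using const_lit_eqD[OF c[OF that(1)] that(2,3)] .
  have "holds_atom z z' p \<longleftrightarrow> holds_atom w w' p" if "p \<in> atoms g" for p
  proof -
    have "atom_terms p \<subseteq> set ?zs" "basic_atom p" "atom_consts p \<subseteq> {d1..d\<alpha>}"
      using g that by (auto simp: over_def basic_def)
    then show ?thesis using rel const by (cases p) auto
  qed
  then show ?thesis by (induction g) auto
qed

lemma over_type:
  assumes "f \<in> types d1 d\<alpha> (cterms \<beta>)"
  shows "over \<beta> f"
proof -
  let ?zs = "cterms \<beta>"
  obtain cs rs where cr: "f = foldr And (cs @ rs) TT"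
    "list_all2 (\<lambda>c z. c \<in> const_lits d1 d\<alpha> z) cs ?zs"
    "list_all2 (\<lambda>r p. r \<in> rel_lits p) rs (ordered_pairs ?zs)"
    using assms unfolding types_def by blast
  have "atom_terms p \<subseteq> set ?zs" if "c \<in> set cs" "p \<in> atoms c" for c p
  proof -
    obtain t where "t \<in> set ?zs" "c \<in> const_lits d1 d\<alpha> t"
      using cr(2) \<open>c \<in> set cs\<close> unfolding list_all2_conv_all_nth in_set_conv_nth by metis
    then show ?thesis using that by (auto simp: const_lits_def)
  qed
  moreover have "atom_terms p \<subseteq> set ?zs" if "r \<in> set rs" "p \<in> atoms r" for r p
  proof -
    obtain s t where "(s, t) \<in> set (ordered_pairs ?zs)" "r \<in> rel_lits (s, t)"
      using cr(3) \<open>r \<in> set rs\<close> unfolding list_all2_conv_all_nth in_set_conv_nth by (metis surj_pair)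
    then show ?thesis using that by (auto simp: rel_lits_def set_ordered_pairs)
  qed
  ultimately show ?thesis unfolding over_def cr(1) atoms_conj set_append by blast
qed

section \<open>Number of types\<close>

lemma finite_card_list_all2:
  assumes "\<And>z. finite (P z)" "\<And>z. card (P z) \<le> K"
  shows "finite {xs. list_all2 (\<lambda>x z. x \<in> P z) xs zs} \<and>
    card {xs. list_all2 (\<lambda>x z. x \<in> P z) xs zs} \<le> K ^ length zs"
proof (induction zs)
  case Nil
  then show ?case by simp
next
  case (Cons z zs)
  let ?L = "{xs. list_all2 (\<lambda>x z. x \<in> P z) xs zs}"
  have eq: "{xs. list_all2 (\<lambda>x z. x \<in> P z) xs (z # zs)} = (\<lambda>(x, xs). x # xs) ` (P z \<times> ?L)"
    by (auto simp: list_all2_Cons2)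
  have "card ((\<lambda>(x, xs). x # xs) ` (P z \<times> ?L)) \<le> card (P z) * card ?L"
    using Cons assms(1) by (metis card_cartesian_product card_image_le finite_cartesian_product)
  also have "\<dots> \<le> K * K ^ length zs" using Cons assms(2) by (intro mult_mono) auto
  finally show ?case using Cons assms(1) unfolding eq by simp
qed

lemma finite_card_const_lits:
  assumes "d1 \<le> d\<alpha>"
  shows "finite (const_lits d1 d\<alpha> t)" "card (const_lits d1 d\<alpha> t) \<le> nat (d\<alpha> - d1) + 3"
proof -
  have eq: "const_lits d1 d\<alpha> t = {Atom (LtC t d1), Atom (GtC t d\<alpha>)} \<union> (\<lambda>d. Atom (EqC t d)) ` {d1..d\<alpha>}"
    by (auto simp: const_lits_def)
  show "finite (const_lits d1 d\<alpha> t)" unfolding eq by simp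
  have "card (const_lits d1 d\<alpha> t) \<le> card {Atom (LtC t d1), Atom (GtC t d\<alpha>)} + card ((\<lambda>d. Atom (EqC t d)) ` {d1..d\<alpha>})"
    unfolding eq by (rule card_Un_le)
  also have "\<dots> \<le> 2 + card {d1..d\<alpha>}" by (intro add_mono card_image_le) auto
  finally show "card (const_lits d1 d\<alpha> t) \<le> nat (d\<alpha> - d1) + 3" using assms by simp
qed

lemma finite_card_rel_lits: "finite (rel_lits p)" "card (rel_lits p) \<le> 3"
proof -
  have card: "card {x, y, z} \<le> 3" for x y z :: 'a
    using card_insert_le_m1[of 3 "{y, z}" x] card_insert_le_m1[of 2 "{z}" y] by simp
  show "finite (rel_lits p)" "card (rel_lits p) \<le> 3"
    unfolding rel_lits_def case_prod_beta by (simp, rule card)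
qed

text \<open>There is one constant literal for each of the 2\<beta> terms and one of three relations
  for each of the 2\<beta>^2 - \<beta> pairs.\<close>

lemma finite_card_SatTypes:
  assumes d: "d1 \<le> d\<alpha>"
  shows "finite (SatTypes d1 d\<alpha> \<beta>)"
    "card (SatTypes d1 d\<alpha> \<beta>) \<le> (nat (d\<alpha> - d1) + 3) ^ (2 * \<beta>) * 3 ^ (2 * \<beta>\<^sup>2)"
proof -
  let ?zs = "cterms \<beta>"
  define Cs where "Cs = {cs. list_all2 (\<lambda>c z. c \<in> const_lits d1 d\<alpha> z) cs ?zs}"
  define Rs where "Rs = {rs. list_all2 (\<lambda>r p. r \<in> rel_lits p) rs (ordered_pairs ?zs)}"
  have Cs: "finite Cs" "card Cs \<le> (nat (d\<alpha> - d1) + 3) ^ (2 * \<beta>)"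
    using finite_card_list_all2[OF finite_card_const_lits[OF d], where zs = ?zs] by (auto simp: Cs_def length_cterms)
  have Rs: "finite Rs" "card Rs \<le> 3 ^ length (ordered_pairs ?zs)"
    using finite_card_list_all2[OF finite_card_rel_lits, where zs = "ordered_pairs ?zs"] by (auto simp: Rs_def)
  have "length (ordered_pairs ?zs) \<le> 2 * \<beta>\<^sup>2"
    using length_ordered_pairs[of ?zs] by (simp add: length_cterms power_mult_distrib)
  then have "(3::nat) ^ length (ordered_pairs ?zs) \<le> 3 ^ (2 * \<beta>\<^sup>2)" by (rule power_increasing) simp
  then have Rs': "card Rs \<le> 3 ^ (2 * \<beta>\<^sup>2)" using Rs(2) by linarith
  have sub: "SatTypes d1 d\<alpha> \<beta> \<subseteq> (\<lambda>(cs, rs). foldr And (cs @ rs) TT) ` (Cs \<times> Rs)"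
    unfolding SatTypes_def types_def Cs_def Rs_def by force
  have fin: "finite (Cs \<times> Rs)" using Cs Rs by simp
  show "finite (SatTypes d1 d\<alpha> \<beta>)" using sub fin by (meson finite_imageI finite_subset)
  have "card (SatTypes d1 d\<alpha> \<beta>) \<le> card (Cs \<times> Rs)"
    using sub fin by (meson card_image_le card_mono finite_imageI le_trans)
  also have "\<dots> \<le> (nat (d\<alpha> - d1) + 3) ^ (2 * \<beta>) * 3 ^ (2 * \<beta>\<^sup>2)"
    using Cs(2) Rs' by (simp add: card_cartesian_product mult_mono)
  finally show "card (SatTypes d1 d\<alpha> \<beta>) \<le> \<dots>" .
qed

section \<open>Size of types\<close>

lemma floorlog_le: "floorlog 2 m \<le> m"
  by (rule floorlog_leI) (auto simp: less_exp)

text \<open>One of the endpoints is at least as large as \<open>d\<close> in absolute value. The 2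
  pays for the sign and for the extra digit beyond the rounded-down logarithm.\<close>

lemma int_size_le:
  assumes "d1 \<le> d" "d \<le> d\<alpha>"
  shows "int_size d + \<beta> \<le> size_param \<beta> d1 d\<alpha> + 2"
proof (cases "d = 0")
  case True
  then show ?thesis by (simp add: int_size_def size_param_def floorlog_def)
next
  case False
  define e where "e = (if \<bar>d\<bar> \<le> \<bar>d1\<bar> then d1 else d\<alpha>)"
  have e: "\<bar>d\<bar> \<le> \<bar>e\<bar>" using assms by (auto simp: e_def)
  then have "log 2 \<bar>real_of_int d\<bar> \<le> log 2 \<bar>real_of_int e\<bar>" using False by (subst log_le_cancel_iff) auto
  then have "\<lceil>log 2 \<bar>real_of_int d\<bar>\<rceil> \<le> \<lceil>log 2 \<bar>real_of_int e\<bar>\<rceil>" by (rule ceiling_mono)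
  also have "\<dots> \<le> max \<lceil>log 2 \<bar>real_of_int d1\<bar>\<rceil> \<lceil>log 2 \<bar>real_of_int d\<alpha>\<bar>\<rceil>" by (simp add: e_def)
  finally have "\<lfloor>log 2 \<bar>real_of_int d\<bar>\<rfloor> \<le> max \<lceil>log 2 \<bar>real_of_int d1\<bar>\<rceil> \<lceil>log 2 \<bar>real_of_int d\<alpha>\<bar>\<rceil>"
    by (meson floor_le_ceiling order_trans)
  then show ?thesis using False by (simp add: int_size_def size_param_def floorlog_def nat_mono del: max.bounded_iff)
qed

lemma constr_size_conj:
  "\<forall>f\<in>set fs. constr_size f \<le> b \<Longrightarrow> constr_size (foldr And fs TT) \<le> 1 + length fs * (1 + b)"
  by (induction fs) auto

text \<open>With P the size parameter, at most 2P^2 + P literals cost at most 4 + 2P each, plus 1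
  for \<open>And\<close>; with the final \<open>TT\<close> this multiplies out to the cubic.\<close>

lemma constr_size_type:
  assumes "d1 \<le> d\<alpha>" "f \<in> types d1 d\<alpha> (cterms \<beta>)"
  shows "constr_size f \<le> poly [:1, 5, 12, 4:] (size_param \<beta> d1 d\<alpha>)"
proof -
  let ?zs = "cterms \<beta>" and ?P = "size_param \<beta> d1 d\<alpha>"
  obtain cs rs where cr: "f = foldr And (cs @ rs) TT"
    "list_all2 (\<lambda>c z. c \<in> const_lits d1 d\<alpha> z) cs ?zs"
    "list_all2 (\<lambda>r p. r \<in> rel_lits p) rs (ordered_pairs ?zs)"
    using assms unfolding types_def by blast
  have P: "\<beta> \<le> ?P" by (simp add: size_param_def)
  have term_size: "term_size t \<le> 1 + \<beta>" if t: "t \<in> set ?zs" for t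
  proof -
    obtain j where "j < \<beta>" "t = Cur j \<or> t = Nxt j" using t by (auto simp: cterms_def)
    then show ?thesis using floorlog_le[of j] by auto
  qed
  have "constr_size c \<le> 4 + 2 * ?P" if c: "c \<in> set cs" for c
  proof -
    obtain t where t: "t \<in> set ?zs" "c \<in> const_lits d1 d\<alpha> t"
      using cr(2) c unfolding list_all2_conv_all_nth in_set_conv_nth by metis
    then obtain d where d: "d1 \<le> d" "d \<le> d\<alpha>" "c \<in> {Atom (LtC t d), Atom (GtC t d), Atom (EqC t d)}"
      using assms(1) by (auto simp: const_lits_def)
    then have "constr_size c = 1 + term_size t + int_size d" by auto
    then show ?thesis using term_size[OF t(1)] int_size_le[OF d(1,2), of \<beta>] by linarith
  qed
  moreover have "constr_size r \<le> 4 + 2 * ?P" if r: "r \<in> set rs" for r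
  proof -
    obtain s t where "(s, t) \<in> set (ordered_pairs ?zs)" and rl: "r \<in> rel_lits (s, t)"
      using cr(3) r unfolding list_all2_conv_all_nth in_set_conv_nth by (metis surj_pair)
    then have "s \<in> set ?zs" "t \<in> set ?zs" by (auto simp: set_ordered_pairs)
    have "constr_size r = 1 + term_size s + term_size t" using rl by (auto simp: rel_lits_def)
    then show ?thesis
      using term_size[OF \<open>s \<in> set ?zs\<close>] term_size[OF \<open>t \<in> set ?zs\<close>] P by linarith
  qed
  ultimately have size: "constr_size f \<le> 1 + length (cs @ rs) * (5 + 2 * ?P)"
    using constr_size_conj[of "cs @ rs" "4 + 2 * ?P"] unfolding cr(1) by auto
  \<comment> \<open>2\<beta> constant literals and 2\<beta>^2 - \<beta> relation literals.\<close>
  have len: "length (cs @ rs) = 2 * \<beta>\<^sup>2 + \<beta>"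
    using length_ordered_pairs[of ?zs] list_all2_lengthD[OF cr(2)] list_all2_lengthD[OF cr(3)]
    by (simp add: length_cterms power_mult_distrib)
  have "2 * \<beta>\<^sup>2 + \<beta> \<le> 2 * ?P\<^sup>2 + ?P" using P by (simp add: add_mono power_mono)
  then have "length (cs @ rs) * (5 + 2 * ?P) \<le> (2 * ?P\<^sup>2 + ?P) * (5 + 2 * ?P)"
    unfolding len by (rule mult_le_mono1)
  then have "constr_size f \<le> 1 + (2 * ?P\<^sup>2 + ?P) * (5 + 2 * ?P)" using size by linarith
  also have "\<dots> = poly [:1, 5, 12, 4:] ?P" by (simp add: algebra_simps power2_eq_square)
  finally show ?thesis .
qed

section \<open>The Rabin automaton\<close>

lemma strict_sorted_bounds:
  assumes "sorted_wrt (<) ds" "d \<in> set (ds :: int list)"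
  shows "hd ds \<le> d" "d \<le> last ds"
proof -
  obtain i where "i < length ds" "d = ds ! i" using assms(2) by (auto simp: in_set_conv_nth)
  moreover have "sorted ds" using assms(1) by (rule strict_sorted_imp_sorted)
  moreover have "ds \<noteq> []" using assms(2) by auto
  ultimately show "hd ds \<le> d" "d \<le> last ds"
    by (auto simp: hd_conv_nth last_conv_nth intro: sorted_nth_mono)
qed

text \<open>Quantifying over the valuations makes the relation depend on the letter and the type
  alone. For a type, any satisfying pair gives the same answer (\<open>rel_of_iff\<close>).\<close>

definition rel_of :: "('q, 'a) buchi_aut \<Rightarrow> 'a \<Rightarrow> constr \<Rightarrow> ('q \<times> 'q) set" where
  "rel_of A a f = {(q, q'). \<exists>g z z'. (q, a, g, q') \<in> delta A \<and>
     length z = nvars A \<and> length z' = nvars A \<and> holds z z' f \<and> holds z z' g}"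

text \<open>\<open>enc\<close> numbers the states, so that the locations of the new automaton are
  natural numbers.\<close>

locale determinization =
  fixes A :: "('q, 'a) buchi_aut" and enc :: "'q dstate \<Rightarrow> nat" and d1 d\<alpha> :: int
  assumes buchi: "buchi_aut A" and d: "d1 \<le> d\<alpha>" and const_bounds: "constants A \<subseteq> {d1..d\<alpha>}"
    and inj_enc: "inj_on enc (dstates (locs A))"
begin

abbreviation "Q \<equiv> locs A"
abbreviation "n \<equiv> 2 * card (locs A)"
abbreviation "Types \<equiv> SatTypes d1 d\<alpha> (nvars A)"
abbreviation "nxt a f \<equiv> step n (accepting A) (rel_of A a f)"

definition det :: "(nat, 'a) rabin_aut" where
  "det = \<lparr>locs = enc ` dstates Q, alphabet = alphabet A, nvars = nvars A,
     inits = {enc (start n (inits A))},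
     delta = {(enc s, a, f, enc (nxt a f s)) | s a f. s \<in> dstates Q \<and> a \<in> alphabet A \<and> f \<in> Types},
     rabin_pairs = (\<lambda>k. (enc ` {s \<in> dstates Q. k \<in> flash s}, enc ` {s \<in> dstates Q. k \<in> reset s})) ` {..<n}\<rparr>"

lemma det_sel [simp]:
  "locs det = enc ` dstates Q" "alphabet det = alphabet A" "nvars det = nvars A"
  "inits det = {enc (start n (inits A))}"
  "delta det = {(enc s, a, f, enc (nxt a f s)) | s a f. s \<in> dstates Q \<and> a \<in> alphabet A \<and> f \<in> Types}"
  "rabin_pairs det = (\<lambda>k. (enc ` {s \<in> dstates Q. k \<in> flash s}, enc ` {s \<in> dstates Q. k \<in> reset s})) ` {..<n}"
  by (simp_all add: det_def)

lemma finite_Q: "finite Q" and finite_alphabet: "finite (alphabet A)" and inits_subset: "inits A \<subseteq> Q"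
  and delta_subset: "delta A \<subseteq> Q \<times> alphabet A \<times> {f. over (nvars A) f} \<times> Q"
  using buchi by (simp_all add: buchi_aut_def aut_def)

lemma accepting_finite: "finite (accepting A)"
  using buchi finite_Q by (auto simp: buchi_aut_def intro: finite_subset)

lemma rel_of_subset: "rel_of A a f \<subseteq> Q \<times> Q"
  using delta_subset by (auto simp: rel_of_def)

lemma start_in: "start n (inits A) \<in> dstates Q"
  by (rule start_in_dstates[OF inits_subset])

lemma nxt_in: "nxt a f s \<in> dstates Q"
  by (rule step_in_dstates[OF rel_of_subset])

lemma rel_of_iff:
  assumes "f \<in> Types" "holds z z' f" "length z = nvars A" "length z' = nvars A"
  shows "(q, q') \<in> rel_of A a f \<longleftrightarrow> (\<exists>g. (q, a, g, q') \<in> delta A \<and> holds z z' g)"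
proof
  assume "(q, q') \<in> rel_of A a f"
  then obtain g w w' where g: "(q, a, g, q') \<in> delta A" "holds w w' f" "holds w w' g"
    by (auto simp: rel_of_def)
  have "over (nvars A) g" using g(1) delta_subset by auto
  moreover have "basic g" using g(1) buchi by (auto simp: buchi_aut_def)
  moreover have "\<Union>(atom_consts ` atoms g) \<subseteq> {d1..d\<alpha>}"
    using const_bounds g(1) unfolding constants_def by fast
  moreover have "f \<in> types d1 d\<alpha> (cterms (nvars A))" using assms(1) by (simp add: SatTypes_def)
  ultimately have "holds z z' g" using holds_cong_type[OF d _ assms(2) g(2)] g(3) by blast
  then show "\<exists>g. (q, a, g, q') \<in> delta A \<and> holds z z' g" using g(1) by blast
qed (use assms in \<open>auto simp: rel_of_def\<close>)

lemma unique_type: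
  assumes "length z = nvars A" "length z' = nvars A"
  shows "f \<in> Types \<and> holds z z' f \<longleftrightarrow> f = type_of d1 d\<alpha> (cterms (nvars A)) z z'"
  using type_of_in_SatTypes[OF d assms] holds_type_iff[OF d, of f] unfolding SatTypes_def by blast

text \<open>Exactly one type is true under the valuations, and it fixes the successor. This gives
  both determinism and the existence of a step.\<close>

lemma delta_det_iff:
  assumes "s \<in> dstates Q" "a \<in> alphabet A" "length z = nvars A" "length z' = nvars A"
  shows "(enc s, a, f, q') \<in> delta det \<and> holds z z' f \<longleftrightarrow>
    f = type_of d1 d\<alpha> (cterms (nvars A)) z z' \<and> q' = enc (nxt a f s)"
proof -
  have "(enc s, a, f, q') \<in> delta det \<longleftrightarrow> f \<in> Types \<and> q' = enc (nxt a f s)"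
    using assms(1,2) inj_onD[OF inj_enc _ assms(1)] by auto
  then show ?thesis using unique_type[OF assms(3,4), of f] by blast
qed

lemma finite_delta_det: "finite (delta det)"
  and card_delta_det: "card (delta det) \<le> (card (locs det))\<^sup>2 * card (alphabet A) *
     ((nat (d\<alpha> - d1) + 3) ^ (2 * nvars A) * 3 ^ (2 * (nvars A)\<^sup>2))"
proof -
  let ?X = "locs det \<times> alphabet A \<times> Types \<times> locs det"
  have sub: "delta det \<subseteq> ?X" using nxt_in by auto
  have fin: "finite ?X"
    using card_dstates(1)[OF finite_Q] finite_alphabet finite_card_SatTypes(1)[OF d] by simp
  show "finite (delta det)" using sub fin by (rule finite_subset)
  have "card (delta det) \<le> card ?X" using fin sub by (rule card_mono)
  also have "\<dots> = (card (locs det))\<^sup>2 * card (alphabet A) * card Types"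
    by (simp add: card_cartesian_product power2_eq_square)
  also have "\<dots> \<le> (card (locs det))\<^sup>2 * card (alphabet A) *
     ((nat (d\<alpha> - d1) + 3) ^ (2 * nvars A) * 3 ^ (2 * (nvars A)\<^sup>2))"
    by (intro mult_le_mono2 finite_card_SatTypes[OF d])
  finally show "card (delta det) \<le> \<dots>" .
qed

lemma rabin_aut_det: "rabin_aut det"
proof -
  have "delta det \<subseteq> locs det \<times> alphabet det \<times> {f. over (nvars det) f} \<times> locs det"
    using nxt_in over_type by (auto simp: SatTypes_def)
  then have "aut det"
    using finite_delta_det card_dstates(1)[OF finite_Q] finite_alphabet start_in
    unfolding aut_def by simp
  then show ?thesis unfolding rabin_aut_def by auto
qed

lemma deterministic_det: "deterministic det"
  unfolding deterministic_def
proof (intro ballI allI impI)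
  fix q a and z z' :: "int list"
  assume "q \<in> locs det" "a \<in> alphabet det" and z: "length z = nvars det \<and> length z' = nvars det"
  then obtain s where s: "s \<in> dstates Q" "q = enc s" and a: "a \<in> alphabet A" by auto
  show "\<exists>\<^sub>\<le>\<^sub>1 (f, q'). (q, a, f, q') \<in> delta det \<and> holds z z' f"
    unfolding s(2) Uniq_def using delta_det_iff[OF s(1) a, of z z'] z
    by (auto simp del: det_sel(5))
qed

text \<open>For a fixed data word, runs of \<open>A\<close> are paths through the relations of its
  types, and the only run of \<open>det\<close> is the encoded state sequence of the
  acceptor.\<close>

lemma lang_det: "buchi_lang A = rabin_lang det"
proof -
  have "(\<exists>r. run A w r \<and> (\<exists>q \<in> accepting A. \<exists>\<^sub>\<infinity>i. r i = q)) \<longleftrightarrow>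
    (\<exists>r. run det w r \<and> (\<exists>(L, U) \<in> rabin_pairs det. (\<exists>\<^sub>\<infinity>i. r i \<in> L) \<and> \<not> (\<exists>\<^sub>\<infinity>i. r i \<in> U)))"
    (is "?B \<longleftrightarrow> ?D")
    if "w \<in> data_words A" for w
  proof -
    have w: "fst (w i) \<in> alphabet A" "length (snd (w i)) = nvars A" for i
      using that by (auto simp: data_words_def)
    define ty where "ty = (\<lambda>i. type_of d1 d\<alpha> (cterms (nvars A)) (snd (w i)) (snd (w (Suc i))))"
    define R where "R = (\<lambda>i. rel_of A (fst (w i)) (ty i))"
    interpret rw: relation_word Q "inits A" "accepting A" R
      by unfold_locales (use finite_Q inits_subset rel_of_subset in \<open>auto simp: R_def\<close>)
    have ty: "ty i \<in> Types" "holds (snd (w i)) (snd (w (Suc i))) (ty i)" for i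
      using unique_type[OF w(2)[of i] w(2)[of "Suc i"], of "ty i"] by (simp_all add: ty_def)
    have "run A w r \<longleftrightarrow> r 0 \<in> inits A \<and> (\<forall>i. (r i, r (Suc i)) \<in> R i)" for r
      unfolding run_def R_def rel_of_iff[OF ty w(2) w(2)] ..
    \<comment> \<open>Since \<open>accepting A\<close> is finite, infinitely many visits to it
      repeat one of its locations infinitely often.\<close>
    moreover have "(\<exists>q \<in> accepting A. \<exists>\<^sub>\<infinity>i. r i = q) \<longleftrightarrow> (\<exists>\<^sub>\<infinity>i. r i \<in> accepting A)" for r :: "nat \<Rightarrow> 'q"
      using frequently_bex_finite_distrib[OF accepting_finite, of "\<lambda>i q. r i = q" cofinite] by simp
    ultimately have B: "?B \<longleftrightarrow> (\<exists>r. rw.accepting_run r)" by (simp add: rw.accepting_run_def)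
    have st0: "rw.st 0 = start n (inits A)"
      by (simp only: rw.st.simps rw.n_def)
    have st_Suc: "rw.st (Suc i) = nxt (fst (w i)) (ty i) (rw.st i)" for i
      unfolding rw.st.simps(2) rw.n_def unfolding R_def ..
    have st: "rw.st i \<in> dstates Q" for i
      by (cases i) (simp_all only: st0 st_Suc start_in nxt_in)
    have step_iff: "(\<exists>f. (enc (rw.st i), fst (w i), f, q') \<in> delta det \<and>
        holds (snd (w i)) (snd (w (Suc i))) f) \<longleftrightarrow> q' = enc (rw.st (Suc i))" for i q'
      unfolding delta_det_iff[OF st w(1) w(2) w(2)] st_Suc ty_def by blast
    have run: "run det w r \<longleftrightarrow> r = (\<lambda>i. enc (rw.st i))" for r
    proof
      assume r: "run det w r"
      have "r i = enc (rw.st i)" for i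
      proof (induction i)
        case 0
        then show ?case using r by (simp add: run_def st0 del: det_sel(5))
      next
        case (Suc i)
        have "\<exists>f. (r i, fst (w i), f, r (Suc i)) \<in> delta det \<and> holds (snd (w i)) (snd (w (Suc i))) f"
          using r unfolding run_def by blast
        then show ?case unfolding Suc step_iff .
      qed
      then show "r = (\<lambda>i. enc (rw.st i))" by blast
    next
      assume "r = (\<lambda>i. enc (rw.st i))"
      then show "run det w r" unfolding run_def using step_iff by (simp add: st0 del: det_sel(5))
    qed
    have mem: "enc (rw.st i) \<in> enc ` {s \<in> dstates Q. P s} \<longleftrightarrow> P (rw.st i)" for i P
      using inj_enc st[of i] by (auto dest: inj_onD)
    have "?D \<longleftrightarrow> (\<exists>k<n. (\<exists>\<^sub>\<infinity>i. k \<in> flash (rw.st i)) \<and> \<not> (\<exists>\<^sub>\<infinity>i. k \<in> reset (rw.st i)))"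
      unfolding run by (simp add: mem Bex_def lessThan_def)
    then show ?thesis unfolding B rw.accepting_run_iff_flashing rw.n_def by blast
  qed
  moreover have "data_words det = data_words A" by (simp add: data_words_def)
  ultimately show ?thesis unfolding buchi_lang_def rabin_lang_def by blast
qed

lemma card_pairs_det: "card (rabin_pairs det) \<le> n"
  unfolding det_sel(6) using card_image_le[of "{..<n}"] by force

lemma card_locs_det: "card (locs det) \<le> 2 ^ poly [:0, 5, 5:] (card Q)"
proof -
  have "card (locs det) \<le> card (dstates Q)" by (simp add: card_dstates(1)[OF finite_Q] card_image_le)
  also have "\<dots> \<le> 2 ^ poly [:0, 5, 5:] (card Q)"
    using card_dstates(2)[OF finite_Q] by (simp add: algebra_simps)
  finally show ?thesis .
qed

lemma delta_det_types:
  "\<forall>(q, a, f, q') \<in> delta det. f \<in> Types \<and>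
    constr_size f \<le> poly [:1, 5, 12, 4:] (size_param (nvars A) d1 d\<alpha>)"
  using constr_size_type[OF d] by (auto simp: SatTypes_def simp del: poly_pCons)

end

text \<open>Both polynomials are chosen before the automaton, so the bounds are uniform.\<close>

theorem theorem7p2:
  shows "\<exists>(p :: nat poly) (s :: nat poly). degree s = 3 \<and>
    (\<forall>(A :: ('q, 'a) buchi_aut) (ds :: int list) d1 d\<alpha>.
       buchi_aut A \<and> ds \<noteq> [] \<and> sorted_wrt (<) ds \<and> constants A \<subseteq> set ds \<and>
       d1 = hd ds \<and> d\<alpha> = last ds \<longrightarrow>
       (\<exists>A' :: (nat, 'a) rabin_aut.
          rabin_aut A' \<and> deterministic A' \<and>
          alphabet A' = alphabet A \<and> nvars A' = nvars A \<and>
          buchi_lang A = rabin_lang A' \<and>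
          card (locs A') \<le> 2 ^ poly p (card (locs A)) \<and>
          card (rabin_pairs A') \<le> 2 * card (locs A) \<and>
          (\<forall>(q, a, f, q') \<in> delta A'.
             f \<in> SatTypes d1 d\<alpha> (nvars A) \<and>
             constr_size f \<le> poly s (size_param (nvars A) d1 d\<alpha>)) \<and>
          card (delta A') \<le> (card (locs A'))\<^sup>2 * card (alphabet A) *
             ((nat (d\<alpha> - d1) + 3) ^ (2 * nvars A) * 3 ^ (2 * (nvars A)\<^sup>2))))"
proof (rule exI[of _ "[:0, 5, 5:]"], rule exI[of _ "[:1, 5, 12, 4:]"], intro conjI allI impI)
  show "degree ([:1, 5, 12, 4:] :: nat poly) = 3" by simp
next
  fix A :: "('q, 'a) buchi_aut" and ds :: "int list" and d1 d\<alpha> :: int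
  assume asm: "buchi_aut A \<and> ds \<noteq> [] \<and> sorted_wrt (<) ds \<and> constants A \<subseteq> set ds \<and>
       d1 = hd ds \<and> d\<alpha> = last ds"
  have "finite (locs A)" using asm by (simp add: buchi_aut_def aut_def)
  \<comment> \<open>The state space is finite and so can be numbered, whatever the type of the
    locations of \<open>A\<close>.\<close>
  then obtain enc :: "'q dstate \<Rightarrow> nat" where "inj_on enc (dstates (locs A))"
    using finite_imp_inj_to_nat_seg[OF card_dstates(1)] by blast
  moreover have "constants A \<subseteq> {d1..d\<alpha>}" using asm strict_sorted_bounds by fastforce
  moreover have "d1 \<le> d\<alpha>" using asm strict_sorted_bounds(1)[of ds "last ds"] by simp
  ultimately interpret determinization A enc d1 d\<alpha> using asm by unfold_locales simp_all
  show "\<exists>A' :: (nat, 'a) rabin_aut.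
          rabin_aut A' \<and> deterministic A' \<and>
          alphabet A' = alphabet A \<and> nvars A' = nvars A \<and>
          buchi_lang A = rabin_lang A' \<and>
          card (locs A') \<le> 2 ^ poly [:0, 5, 5:] (card (locs A)) \<and>
          card (rabin_pairs A') \<le> 2 * card (locs A) \<and>
          (\<forall>(q, a, f, q') \<in> delta A'.
             f \<in> SatTypes d1 d\<alpha> (nvars A) \<and>
             constr_size f \<le> poly [:1, 5, 12, 4:] (size_param (nvars A) d1 d\<alpha>)) \<and>
          card (delta A') \<le> (card (locs A'))\<^sup>2 * card (alphabet A) *
             ((nat (d\<alpha> - d1) + 3) ^ (2 * nvars A) * 3 ^ (2 * (nvars A)\<^sup>2))"
    using rabin_aut_det deterministic_det det_sel(2,3) lang_det card_locs_det card_pairs_det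
      delta_det_types card_delta_det
    by (intro exI[of _ det] conjI)
qed

end
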